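(* Let $\mathfrak g$ be of type $A_{n-1}^{(1)}$, let $L$ be a multiplicity array, and let $\lambda=(\lambda_1,\ldots,\lambda_n)$ be an $n$-tuple of nonnegative integers with $\sum_{i=1}^n\lambda_i=\sum_{(a,i)\in\mathcal H}a\,i\,L_i^{(a)}$. Let $M(L,\lambda)=\sum_{(\nu,J)\in\mathrm{RC}(L,\lambda)}q^{cc(\nu,J)}$. Then $$M(L,\lambda)=\sum_{S\in\mathcal{SA}(\lambda')}(-1)^{|S|+1}\sum_{\nu\in\mathrm C(L,\lambda)}q^{cc(\nu)+\sum_{(a,i)\in\mathcal H}m_i^{(a)}M_i^{(a)}(S)}\prod_{(a,i)\in\mathcal H}\genfrac{[}{]}{0pt}{}{m_i^{(a)}+p_i^{(a)}-M_i^{(a)}(S)}{m_i^{(a)}}.$$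
   Context: Setting: $\overline I=\{1,\ldots,n-1\}$ is the index set of the underlying finite type $A_{n-1}$, with simple roots $\alpha_a$, fundamental weights $\Lambda_a$, and Cartan matrix $A_{ab}=(\alpha_a|\alpha_b)$. Put $\mathcal H=\overline I\times\mathbb Z_{>0}$. A multiplicity array is $L=(L_i^{(a)}\mid(a,i)\in\mathcal H)$ with nonnegative integer entries, finitely many nonzero. The tuple $\lambda$ corresponds to the weight $\Lambda=\sum_{i\in\overline I}(\lambda_i-\lambda_{i+1})\Lambda_i$, and $\lambda$ and $\Lambda$ are used interchangeably. Configurations: $\mathrm C(L,\lambda)$ is the set of $(L,\lambda)$-configurations, i.e. sequences of partitions $\nu=(\nu^{(a)})_{a\in\overline I}$ with $\sum_{(a,i)\in\mathcal H} i\,m_i^{(a)}\alpha_a=\sum_{(a,i)\in\mathcal H} i\,L_i^{(a)}\Lambda_a-\Lambda$, where $m_i^{(a)}$ is the number of parts of length $i$ in $\nu^{(a)}$. Vacancy numbers: $p_i^{(a)}=\sum_{j\ge1}\min(i,j)L_j^{(a)}-\sum_{(b,j)\in\mathcal H}(\alpha_a|\alpha_b)\min(i,j)m_j^{(b)}$. A configuration is admissible if all $p_i^{(a)}\ge0$. Riggings: a rigging $J$ of $\nu$ assigns to each part of each $\nu^{(a)}$ an integer label, up to permuting labels among equal parts of the same $\nu^{(a)}$. So $(\nu,J)$ amounts to, for each $a$, a finite multiset $(\nu,J)^{(a)}$ of strings $(i,x)$ ($i$ = length, $x$ = label). The colabel of $(i,x)$ in $(\nu,J)^{(a)}$ is $p_i^{(a)}-x$.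 For dominant $\Lambda$, $\overline{\mathrm{RC}}(L,\Lambda)$ is the set of $(\nu,J)$ with $\nu$ an admissible $(L,\Lambda)$-configuration and $0\le x\le p_i^{(a)}$ for every string $(i,x)$ in $(\nu,J)^{(a)}$; $\overline{\mathrm{RC}}(L)$ is the union over all dominant $\Lambda$. Operators, for $a\in\overline I$: (1) $e_a(\nu,J)$: undefined if $(\nu,J)^{(a)}$ has no string with negative label. Otherwise select, among strings of $(\nu,J)^{(a)}$ with the smallest (negative) label, one of smallest length; remove a box from it, increase its label by one (a string of length $1$, whose label is then $-1$, is deleted), and change the labels of all other strings so that their colabels are unchanged. (2) $f_a(\nu,J)$: select, among strings of $(\nu,J)^{(a)}$ with the smallest nonpositive label, one of largest length; add a box to it, decrease its label by one, and change the labels of all other strings so that their colabels are unchanged. If there is no string with nonpositive label, instead add a new string of length $1$ with label $-1$ (keeping all other colabels fixed). If the result is not valid, i.e. some label exceeds the corresponding vacancy number, $f_a(\nu,J)$ is undefined. $\mathrm{RC}(L)$ is the set generated from $\overline{\mathrm{RC}}(L)$ by the operators $e_a,f_a$, $a\in\overline I$. The weight is $\mathrm{wt}(\nu,J)=\sum_{(a,i)\in\mathcal H}i(L_i^{(a)}\Lambda_a-m_i^{(a)}\alpha_a)$, and $\mathrm{RC}(L,\lambda)=\{(\nu,J)\in\mathrm{RC}(L)\mid\mathrm{wt}(\nu,J)=\Lambda\}$. Cocharge: $cc(\nu)=\frac12\sum_{(a,j),(b,k)\in\mathcal H}(\alpha_a|\alpha_b)\min(j,k)m_j^{(a)}m_k^{(b)}$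 and $cc(\nu,J)=cc(\nu)+(\text{sum of all labels in }J)$. Lower bounds: let $c_k=\lambda_{k+1}+\cdots+\lambda_n$ for $1\le k\le n-1$, $c_n=0$, $c_0=c_1$. Let $\lambda'$ be the shape whose $k$-th column has length $c_k$, $1\le k\le n-1$, and let $\mathcal A(\lambda')$ be the set of tableaux $t$ of shape $\lambda'$ (with $t_{j,k}$ the entry in row $j$, column $k$) whose entries are strictly decreasing down columns and such that the letters in column $k$ are from $\{1,\ldots,c_{k-1}\}$. For $t\in\mathcal A(\lambda')$ put $M_i^{(a)}(t)=-\sum_{j=1}^{c_a}\chi(i\ge t_{j,a})+\sum_{j=1}^{c_{a+1}}\chi(i\ge t_{j,a+1})$, where $\chi(S)=1$ if $S$ is true and $0$ otherwise. $\mathcal{SA}(\lambda')$ is the set of all nonempty subsets of $\mathcal A(\lambda')$, and $M_i^{(a)}(S)=\max\{M_i^{(a)}(t)\mid t\in S\}$ for $S\in\mathcal{SA}(\lambda')$. $q$-binomials: $\genfrac{[}{]}{0pt}{}{m+p}{m}=\frac{(q)_{m+p}}{(q)_m(q)_p}$ with $(q)_n=(1-q)(1-q^2)\cdots(1-q^n)$ is the generating function of partitions with at most $m$ parts each not exceeding $p$; accordingly it equals $1$ if $m=0$ (for every integer $p$) and $0$ if $m>0$ and $p<0$. *)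

theory Defs
  imports
    "HOL-Library.Multiset"
    "HOL-Library.FuncSet"
    "HOL-Computational_Algebra.Formal_Laurent_Series"
begin

section \<open>Type $A_{n-1}$ data\<close>

definition idx :: "nat \<Rightarrow> nat set" where
  "idx n = {1..<n}"

definition nodes :: "nat \<Rightarrow> (nat \<times> nat) set" where
  "nodes n = idx n \<times> {1..}"

text \<open>Sums over \<open>nodes n\<close> weighted by a finitely supported array are taken over the
  support of that array, because \<open>sum\<close> over an infinite set is \<open>0\<close>.\<close>

definition supp :: "nat \<Rightarrow> (nat \<Rightarrow> nat \<Rightarrow> nat) \<Rightarrow> (nat \<times> nat) set" where
  "supp n M = {(a, i) \<in> nodes n. M a i \<noteq> 0}"

definition multiplicity_array :: "nat \<Rightarrow> (nat \<Rightarrow> nat \<Rightarrow> nat) \<Rightarrow> bool" where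
  "multiplicity_array n L \<longleftrightarrow> finite (supp n L)"

definition cartan :: "nat \<Rightarrow> nat \<Rightarrow> int" where
  "cartan a b = (if a = b then 2 else if a = b + 1 \<or> b = a + 1 then -1 else 0)"

text \<open>A weight is given by its coordinates in the basis of fundamental weights; coordinates
  outside \<open>idx n\<close> are \<open>0\<close>.\<close>

type_synonym weight = "nat \<Rightarrow> int"

definition fund_weight :: "nat \<Rightarrow> weight" where
  "fund_weight a = (\<lambda>b. of_bool (b = a))"

definition simple_root :: "nat \<Rightarrow> nat \<Rightarrow> weight" where
  "simple_root n a = (\<lambda>b. \<Sum>c\<in>idx n. cartan a c * fund_weight c b)"

definition dominant :: "nat \<Rightarrow> weight \<Rightarrow> bool" where
  "dominant n \<Lambda> \<longleftrightarrow> (\<forall>b\<in>idx n. 0 \<le> \<Lambda> b) \<and> (\<forall>b. b \<notin> idx n \<longrightarrow> \<Lambda> b = 0)"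

definition weight_of_tuple :: "nat \<Rightarrow> (nat \<Rightarrow> nat) \<Rightarrow> weight" where
  "weight_of_tuple n lam =
     (\<lambda>b. \<Sum>a\<in>idx n. (int (lam a) - int (lam (a + 1))) * fund_weight a b)"

section \<open>Configurations\<close>

text \<open>A partition is the multiset of its (positive) parts. Sequences of partitions are
  empty outside \<open>idx n\<close>, so that distinct sequences are distinct functions.\<close>

definition partition_seq :: "nat \<Rightarrow> (nat \<Rightarrow> nat multiset) \<Rightarrow> bool" where
  "partition_seq n \<nu> \<longleftrightarrow>
     (\<forall>a\<in>idx n. 0 \<notin># \<nu> a) \<and> (\<forall>a. a \<notin> idx n \<longrightarrow> \<nu> a = {#})"

definition num_parts :: "(nat \<Rightarrow> nat multiset) \<Rightarrow> nat \<Rightarrow> nat \<Rightarrow> nat" where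
  "num_parts \<nu> a i = count (\<nu> a) i"

definition configs :: "nat \<Rightarrow> (nat \<Rightarrow> nat \<Rightarrow> nat) \<Rightarrow> weight \<Rightarrow> (nat \<Rightarrow> nat multiset) set" where
  "configs n L \<Lambda> = {\<nu>. partition_seq n \<nu> \<and>
     (\<forall>b. (\<Sum>(a, i)\<in>supp n (num_parts \<nu>). int i * int (num_parts \<nu> a i) * simple_root n a b)
        = (\<Sum>(a, i)\<in>supp n L. int i * int (L a i) * fund_weight a b) - \<Lambda> b)}"

definition vacancy ::
  "nat \<Rightarrow> (nat \<Rightarrow> nat \<Rightarrow> nat) \<Rightarrow> (nat \<Rightarrow> nat multiset) \<Rightarrow> nat \<Rightarrow> nat \<Rightarrow> int" where
  "vacancy n L \<nu> a i =
     (\<Sum>j | 1 \<le> j \<and> L a j \<noteq> 0. int (min i j) * int (L a j))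
     - (\<Sum>(b, j)\<in>supp n (num_parts \<nu>). cartan a b * int (min i j) * int (num_parts \<nu> b j))"

definition admissible :: "nat \<Rightarrow> (nat \<Rightarrow> nat \<Rightarrow> nat) \<Rightarrow> (nat \<Rightarrow> nat multiset) \<Rightarrow> bool" where
  "admissible n L \<nu> \<longleftrightarrow> (\<forall>(a, i)\<in>nodes n. 0 \<le> vacancy n L \<nu> a i)"

text \<open>The double sum is even (lemma \<open>even_double_sum\<close> below), so \<open>div\<close> is exact.\<close>

definition cc_config :: "nat \<Rightarrow> (nat \<Rightarrow> nat multiset) \<Rightarrow> int" where
  "cc_config n \<nu> =
     (\<Sum>(a, j)\<in>supp n (num_parts \<nu>). \<Sum>(b, k)\<in>supp n (num_parts \<nu>).
        cartan a b * int (min j k) * int (num_parts \<nu> a j) * int (num_parts \<nu> b k)) div 2"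

section \<open>Rigged configurations\<close>

text \<open>A pair \<open>(\<nu>, J)\<close> is encoded by its multisets of strings (length, label).\<close>

type_synonym rigged = "nat \<Rightarrow> (nat \<times> int) multiset"

definition shape :: "rigged \<Rightarrow> nat \<Rightarrow> nat multiset" where
  "shape rc a = image_mset fst (rc a)"

definition RC_bar :: "nat \<Rightarrow> (nat \<Rightarrow> nat \<Rightarrow> nat) \<Rightarrow> weight \<Rightarrow> rigged set" where
  "RC_bar n L \<Lambda> = {rc. shape rc \<in> configs n L \<Lambda> \<and> admissible n L (shape rc) \<and>
     (\<forall>a\<in>idx n. \<forall>(i, x)\<in>#rc a. 0 \<le> x \<and> x \<le> vacancy n L (shape rc) a i)}"

text \<open>Replace the sub-multiset \<open>old\<close> of strings of \<open>rc a\<close> by \<open>new\<close>; all remaining strings,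
  at every node, get the label that preserves their colabel \<open>p - x\<close>.\<close>

definition replace_strings ::
  "nat \<Rightarrow> (nat \<Rightarrow> nat \<Rightarrow> nat) \<Rightarrow> nat \<Rightarrow> (nat \<times> int) multiset \<Rightarrow> (nat \<times> int) multiset
     \<Rightarrow> rigged \<Rightarrow> rigged" where
  "replace_strings n L a old new rc =
     (let rest = rc(a := rc a - old);
          \<nu> = shape rc;
          \<nu>' = shape (rest(a := rest a + new))
      in (\<lambda>b. image_mset (\<lambda>(i, x). (i, vacancy n L \<nu>' b i - (vacancy n L \<nu> b i - x))) (rest b)
            + (if b = a then new else {#})))"

definition e_op :: "nat \<Rightarrow> (nat \<Rightarrow> nat \<Rightarrow> nat) \<Rightarrow> nat \<Rightarrow> rigged \<Rightarrow> rigged option" where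
  "e_op n L a rc =
     (let X = {x. x < 0 \<and> (\<exists>i. (i, x) \<in># rc a)} in
      if X = {} then None
      else let x = Min X; l = Min {i. (i, x) \<in># rc a} in
        Some (replace_strings n L a {#(l, x)#} (if l = 1 then {#} else {#(l - 1, x + 1)#}) rc))"

definition valid :: "nat \<Rightarrow> (nat \<Rightarrow> nat \<Rightarrow> nat) \<Rightarrow> rigged \<Rightarrow> bool" where
  "valid n L rc \<longleftrightarrow> (\<forall>a\<in>idx n. \<forall>(i, x)\<in>#rc a. x \<le> vacancy n L (shape rc) a i)"

definition f_op :: "nat \<Rightarrow> (nat \<Rightarrow> nat \<Rightarrow> nat) \<Rightarrow> nat \<Rightarrow> rigged \<Rightarrow> rigged option" where
  "f_op n L a rc =
     (let X = {x. x \<le> 0 \<and> (\<exists>i. (i, x) \<in># rc a)};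
          rc' = (if X = {} then replace_strings n L a {#} {#(1, -1)#} rc
                 else let x = Min X; l = Max {i. (i, x) \<in># rc a} in
                   replace_strings n L a {#(l, x)#} {#(l + 1, x - 1)#} rc)
      in if valid n L rc' then Some rc' else None)"

inductive_set RC :: "nat \<Rightarrow> (nat \<Rightarrow> nat \<Rightarrow> nat) \<Rightarrow> rigged set"
  for n :: nat and L :: "nat \<Rightarrow> nat \<Rightarrow> nat" where
  highest: "\<lbrakk>dominant n \<Lambda>; rc \<in> RC_bar n L \<Lambda>\<rbrakk> \<Longrightarrow> rc \<in> RC n L"
| e_step: "\<lbrakk>rc \<in> RC n L; a \<in> idx n; e_op n L a rc = Some rc'\<rbrakk> \<Longrightarrow> rc' \<in> RC n L"
| f_step: "\<lbrakk>rc \<in> RC n L; a \<in> idx n; f_op n L a rc = Some rc'\<rbrakk> \<Longrightarrow> rc' \<in> RC n L"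

definition wt :: "nat \<Rightarrow> (nat \<Rightarrow> nat \<Rightarrow> nat) \<Rightarrow> rigged \<Rightarrow> weight" where
  "wt n L rc = (\<lambda>b.
     (\<Sum>(a, i)\<in>supp n L. int i * int (L a i) * fund_weight a b)
     - (\<Sum>(a, i)\<in>supp n (num_parts (shape rc)).
          int i * int (num_parts (shape rc) a i) * simple_root n a b))"

definition RC_wt :: "nat \<Rightarrow> (nat \<Rightarrow> nat \<Rightarrow> nat) \<Rightarrow> weight \<Rightarrow> rigged set" where
  "RC_wt n L \<Lambda> = {rc \<in> RC n L. wt n L rc = \<Lambda>}"

definition cc_rigged :: "nat \<Rightarrow> rigged \<Rightarrow> int" where
  "cc_rigged n rc = cc_config n (shape rc) + (\<Sum>a\<in>idx n. \<Sum>(i, x)\<in>#rc a. x)"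

section \<open>Lower bounds\<close>

definition col_len :: "nat \<Rightarrow> (nat \<Rightarrow> nat) \<Rightarrow> nat \<Rightarrow> nat" where
  "col_len n lam k = (if k = 0 then \<Sum>i=2..n. lam i else \<Sum>i=k + 1..n. lam i)"

text \<open>Cells are pairs (row, column), and a tableau is an extensional function on the cells.\<close>

definition cells :: "nat \<Rightarrow> (nat \<Rightarrow> nat) \<Rightarrow> (nat \<times> nat) set" where
  "cells n lam = {(j, k). k \<in> idx n \<and> 1 \<le> j \<and> j \<le> col_len n lam k}"

definition tableaux :: "nat \<Rightarrow> (nat \<Rightarrow> nat) \<Rightarrow> (nat \<times> nat \<Rightarrow> nat) set" where
  "tableaux n lam = {t \<in> PiE (cells n lam) (\<lambda>(j, k). {1..col_len n lam (k - 1)}).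
     \<forall>j j' k. (j, k) \<in> cells n lam \<and> (j', k) \<in> cells n lam \<and> j < j' \<longrightarrow> t (j', k) < t (j, k)}"

definition tableau_sets :: "nat \<Rightarrow> (nat \<Rightarrow> nat) \<Rightarrow> (nat \<times> nat \<Rightarrow> nat) set set" where
  "tableau_sets n lam = {S. S \<subseteq> tableaux n lam \<and> S \<noteq> {}}"

definition low :: "nat \<Rightarrow> (nat \<Rightarrow> nat) \<Rightarrow> (nat \<times> nat \<Rightarrow> nat) \<Rightarrow> nat \<Rightarrow> nat \<Rightarrow> int" where
  "low n lam t a i =
     - (\<Sum>j=1..col_len n lam a. of_bool (i \<ge> t (j, a)))
     + (\<Sum>j=1..col_len n lam (a + 1). of_bool (i \<ge> t (j, a + 1)))"

definition low_set ::
  "nat \<Rightarrow> (nat \<Rightarrow> nat) \<Rightarrow> (nat \<times> nat \<Rightarrow> nat) set \<Rightarrow> nat \<Rightarrow> nat \<Rightarrow> int" where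
  "low_set n lam S a i = Max ((\<lambda>t. low n lam t a i) ` S)"

section \<open>Generating functions\<close>

text \<open>Identities in \<open>q\<close> live in the field of formal Laurent series over the rationals.\<close>

abbreviation q :: "rat fls" where
  "q \<equiv> fls_X"

definition q_poch :: "nat \<Rightarrow> rat fls" where
  "q_poch m = (\<Prod>k=1..m. (1 - q ^ k))"

text \<open>\<open>q_binom m p\<close> is the $q$-binomial coefficient with upper entry $m + p$ and lower entry $m$.\<close>

definition q_binom :: "nat \<Rightarrow> int \<Rightarrow> rat fls" where
  "q_binom m p =
     (if m = 0 then 1 else if p < 0 then 0
      else q_poch (m + nat p) / (q_poch m * q_poch (nat p)))"

definition M_gf :: "nat \<Rightarrow> (nat \<Rightarrow> nat \<Rightarrow> nat) \<Rightarrow> (nat \<Rightarrow> nat) \<Rightarrow> rat fls" where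
  "M_gf n L lam = (\<Sum>rc\<in>RC_wt n L (weight_of_tuple n lam). q powi (cc_rigged n rc))"

section \<open>Exactness of the division and finiteness of the index sets\<close>

lemma even_sum_symmetric:
  fixes g :: "'a \<Rightarrow> 'a \<Rightarrow> int"
  assumes "finite A" "\<And>x y. g x y = g y x" "\<And>x. even (g x x)"
  shows "even (\<Sum>x\<in>A. \<Sum>y\<in>A. g x y)"
  using assms(1)
proof (induction A rule: finite_induct)
  case empty
  then show ?case by simp
next
  case (insert z A)
  have "(\<Sum>x\<in>A. g x z) = (\<Sum>x\<in>A. g z x)"
    by (rule sum.cong) (auto intro: assms(2))
  then have "(\<Sum>x\<in>insert z A. \<Sum>y\<in>insert z A. g x y)
      = g z z + 2 * (\<Sum>x\<in>A. g z x) + (\<Sum>x\<in>A. \<Sum>y\<in>A. g x y)"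
    using insert.hyps by (simp add: sum.distrib)
  then show ?case
    using insert.IH assms(3) by simp
qed

lemma supp_num_parts: "supp n (num_parts \<nu>) = Sigma (idx n) (\<lambda>a. set_mset (\<nu> a) - {0})"
  by (auto simp: supp_def nodes_def num_parts_def)

lemma finite_supp_num_parts: "finite (supp n (num_parts \<nu>))"
  unfolding supp_num_parts by (auto simp: idx_def intro: finite_SigmaI)

lemma even_double_sum:
  "even (\<Sum>(a, j)\<in>supp n (num_parts \<nu>). \<Sum>(b, k)\<in>supp n (num_parts \<nu>).
     cartan a b * int (min j k) * int (num_parts \<nu> a j) * int (num_parts \<nu> b k))"
proof -
  let ?g = "\<lambda>x y. cartan (fst x) (fst y) * int (min (snd x) (snd y))
              * int (num_parts \<nu> (fst x) (snd x)) * int (num_parts \<nu> (fst y) (snd y))"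
  have "even (\<Sum>x\<in>supp n (num_parts \<nu>). \<Sum>y\<in>supp n (num_parts \<nu>). ?g x y)"
    by (rule even_sum_symmetric[OF finite_supp_num_parts]) (auto simp: cartan_def min.commute)
  then show ?thesis by (simp add: case_prod_unfold)
qed

lemma finite_tableaux: "finite (tableaux n lam)"
proof -
  have "cells n lam \<subseteq> Sigma {..<n} (\<lambda>k. {..n}) \<union> (\<Union>k<n. {..col_len n lam k} \<times> {k})"
    by (auto simp: cells_def idx_def)
  then have "finite (cells n lam)"
    by (rule finite_subset) auto
  then have "finite (PiE (cells n lam) (\<lambda>(j, k). {1..col_len n lam (k - 1)}))"
    by (intro finite_PiE) auto
  then show ?thesis
    unfolding tableaux_def by (rule rev_finite_subset) auto
qed

lemma finite_tableau_sets: "finite (tableau_sets n lam)"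
  unfolding tableau_sets_def
  by (rule finite_subset[OF _ finite_Pow_iff[THEN iffD2, OF finite_tableaux]]) auto

lemma sum_supp_num_parts:
  "(\<Sum>(a, i)\<in>supp n (num_parts \<nu>). int i * int (num_parts \<nu> a i) * h a)
     = (\<Sum>a\<in>idx n. int (sum_mset (\<nu> a)) * h a)"
proof -
  have *: "int (sum_mset M) = (\<Sum>i\<in>set_mset M - {0}. int i * int (count M i))" for M :: "nat multiset"
  proof -
    have "int (sum_mset M) = (\<Sum>i\<in>A. int i * int (count M i))"
      if "finite A" "set_mset M \<subseteq> A" for A
      using that(2)
    proof (induction M)
      case (add x M)
      have "(\<Sum>i\<in>A. int i * int (count (add_mset x M) i))
          = (\<Sum>i\<in>A. int i * int (count M i) + (if x = i then int i else 0))"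
        by (rule sum.cong) (auto simp: algebra_simps)
      also have "\<dots> = int (sum_mset M) + int x"
        using add that(1) by (simp add: sum.distrib del: of_nat_sum_mset)
      finally show ?case by simp
    qed simp
    from this[of "set_mset M"]
    have "int (sum_mset M) = (\<Sum>i\<in>set_mset M. int i * int (count M i))"
      by simp
    also have "\<dots> = (\<Sum>i\<in>set_mset M - {0}. int i * int (count M i))"
      by (rule sum.mono_neutral_right) auto
    finally show ?thesis .
  qed
  show ?thesis
    unfolding supp_num_parts
    by (subst sum.Sigma[symmetric])
       (auto simp: idx_def * num_parts_def sum_distrib_right simp del: of_nat_sum_mset)
qed

lemma simple_root_apply: "b \<in> idx n \<Longrightarrow> simple_root n a b = cartan a b"
  by (simp add: simple_root_def fund_weight_def idx_def sum.delta)

lemma cartan_sum: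
  fixes z :: "nat \<Rightarrow> int"
  assumes "b \<in> idx n" "z 0 = 0" "z n = 0"
  shows "(\<Sum>a\<in>idx n. z a * cartan a b) = 2 * z b - z (b - 1) - z (b + 1)"
proof -
  have "(\<Sum>a\<in>idx n. z a * cartan a b) = (\<Sum>a\<in>{0..n}. z a * cartan a b)"
    using assms(2,3) by (intro sum.mono_neutral_left) (auto simp: idx_def le_less)
  also have "\<dots> = (\<Sum>a\<in>{b - 1, b, b + 1}. z a * cartan a b)"
    using assms(1) by (intro sum.mono_neutral_right) (auto simp: idx_def cartan_def)
  also have "\<dots> = 2 * z b - z (b - 1) - z (b + 1)"
  proof -
    have "b - 1 \<noteq> b" "b \<noteq> b + 1" "b - 1 \<noteq> b + 1" "b = b - 1 + 1"
      using assms(1) by (auto simp: idx_def)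
    then show ?thesis by (simp add: cartan_def)
  qed
  finally show ?thesis .
qed

lemma cartan_inj:
  fixes z :: "nat \<Rightarrow> int"
  assumes "z 0 = 0" "z n = 0" "\<And>b. b \<in> idx n \<Longrightarrow> 2 * z b = z (b - 1) + z (b + 1)" "k \<le> n"
  shows "z k = 0"
proof -
  have lin: "m \<le> n \<Longrightarrow> z m = int m * z 1" for m
  proof (induction m rule: less_induct)
    case (less m)
    consider "m = 0" | "m = 1" | b where "m = b + 1" "b \<in> idx n"
    proof (cases "m \<le> 1")
      case False
      then have "m = (m - 1) + 1" "m - 1 \<in> idx n"
        using less.prems unfolding idx_def atLeastLessThan_iff by linarith+
      then show ?thesis by (rule that(3))
    qed (use that(1,2) in linarith)
    then show ?case
    proof cases
      case 3
      then have b: "1 \<le> b" "b < m" "b - 1 < m" "b \<le> n" "b - 1 \<le> n"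
        using less.prems by (auto simp: idx_def)
      have "z b = int b * z 1" "z (b - 1) = int (b - 1) * z 1"
        by (rule less.IH; use b in simp)+
      then have "z (b + 1) = 2 * (int b * z 1) - (int b - 1) * z 1"
        using assms(3)[OF 3(2)] b(1) by (simp add: of_nat_diff)
      also have "\<dots> = int (b + 1) * z 1"
        by (simp add: algebra_simps)
      finally show ?thesis using 3(1) by simp
    qed (use assms(1) in simp_all)
  qed
  have "int n * z 1 = 0" using lin[of n] assms(2) by simp
  then show ?thesis using lin[OF assms(4)] assms(4) by (cases "n = 0") simp_all
qed

lemma finite_bounded_multisets: "finite {M :: nat multiset. 0 \<notin># M \<and> sum_mset M \<le> N}"
proof -
  have "M \<in> mset ` {xs. set xs \<subseteq> {..N} \<and> length xs \<le> N}" if "0 \<notin># M" "sum_mset M \<le> N" for M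
  proof -
    obtain xs where xs: "M = mset xs" by (metis ex_mset)
    have "length xs \<le> sum_list xs" if "0 \<notin> set xs" for xs :: "nat list"
      using that by (induction xs) auto
    moreover have "x \<in> set xs \<Longrightarrow> x \<le> sum_list xs" for x
      by (rule member_le_sum_list) simp_all
    ultimately show ?thesis
      using that xs by (fastforce simp: sum_mset_sum_list)
  qed
  moreover have "finite {xs. set xs \<subseteq> {..N} \<and> length xs \<le> N}"
    by (rule finite_lists_length_le) simp
  ultimately show ?thesis
    by (blast intro: finite_subset)
qed

lemma finite_configs: "finite (configs n L \<Lambda>)"
proof (cases "configs n L \<Lambda> = {}")
  case False
  then obtain \<mu> where \<mu>: "\<mu> \<in> configs n L \<Lambda>" by blast
  have size_eq: "sum_mset (\<nu> a) = sum_mset (\<mu> a)" if \<nu>: "\<nu> \<in> configs n L \<Lambda>" for \<nu> a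
  proof (cases "a \<in> idx n")
    case True
    define z where "z k = int (sum_mset (\<nu> k)) - int (sum_mset (\<mu> k))" for k
    have z0: "z 0 = 0" "z n = 0"
      using \<mu> \<nu> by (auto simp: z_def configs_def partition_seq_def idx_def)
    have "2 * z b = z (b - 1) + z (b + 1)" if b: "b \<in> idx n" for b
    proof -
      have "(\<Sum>a\<in>idx n. int (sum_mset (\<nu> a)) * simple_root n a b)
          = (\<Sum>a\<in>idx n. int (sum_mset (\<mu> a)) * simple_root n a b)"
        using \<mu> \<nu> by (simp add: configs_def sum_supp_num_parts del: of_nat_sum_mset)
      then have "(\<Sum>a\<in>idx n. z a * cartan a b) = 0"
        by (simp add: z_def simple_root_apply[OF b] left_diff_distrib sum_subtractf
            del: of_nat_sum_mset)
      then show ?thesis using cartan_sum[OF b z0] by simp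
    qed
    then have "z a = 0"
      using cartan_inj[of z n a] z0 True by (auto simp: idx_def)
    then show ?thesis by (simp add: z_def del: of_nat_sum_mset)
  next
    case False
    then show ?thesis using \<mu> \<nu> by (auto simp: configs_def partition_seq_def)
  qed
  define N where "N = (\<Sum>a\<in>idx n. sum_mset (\<mu> a))"
  have "sum_mset (\<mu> a) \<le> N" if "a \<in> idx n" for a
    unfolding N_def by (rule member_le_sum) (use that in \<open>auto simp: idx_def\<close>)
  then have "configs n L \<Lambda> \<subseteq> {\<nu>. \<forall>a. (a \<in> idx n \<longrightarrow> \<nu> a \<in> {M. 0 \<notin># M \<and> sum_mset M \<le> N})
      \<and> (a \<notin> idx n \<longrightarrow> \<nu> a = {#})}"
    using size_eq by (auto simp: configs_def partition_seq_def)
  moreover have "finite \<dots>"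
    by (rule finite_set_of_finite_funs[OF _ finite_bounded_multisets]) (simp add: idx_def)
  ultimately show ?thesis by (rule finite_subset)
qed simp

end

(*
  The labels of a rigged configuration (nu, J) in RC(L) satisfy J <= p, and they dominate
  M(t) for some tableau t in A(lambda'). Conversely these two conditions characterize RC(L):
  they hold for highest weight elements (take column a equal to {1, ..., c_a}); they are
  preserved by f_a and e_a, each of which requires changing only columns a and a + 1 of t;
  and an element on which all e_a are undefined is of highest weight, since the vacancy
  numbers are concave between the parts of nu. As f_a inverts e_a and e_a removes a box,
  induction on the number of boxes reaches every such element from a highest weight element.

  Hence RC(L, lambda) is the union over t of the sets of riggings with M(t) <= J <= p.
  Inclusion-exclusion gives the alternating sum over sets S of tableaux, and for fixed S and
  nu the labels of the m strings of given node and length form a multiset of integers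
  between M(S) and p, whose generating function is a shifted q-binomial coefficient.
*)

theory Submission
  imports Defs
begin


section \<open>Counting functions of columns\<close>

text \<open>The operators change the weight, so the induction needs a criterion that is not tied to
  one \<open>\<lambda>\<close>: the column lengths are read off the shape by
  \<open>col_size\<close>, and a box added at node \<open>a\<close> changes only c_a. Only the
  existence of a tableau is carried along; the tableau itself may change at every step.

  The column moves are dictated by the labels. When f_a lengthens a string of length
  \<open>l\<close>, the longer strings at node \<open>a\<close> lose 2 and those at
  \<open>a - 1\<close> and \<open>a + 1\<close> gain 1. The bound at node \<open>a\<close> is the
  count of column \<open>a + 1\<close> minus that of column \<open>a\<close>. A new entry beyond
  \<open>l\<close> in column \<open>a\<close> therefore supplies one unit of the loss; the other,
  where needed, comes from an entry taken out of column \<open>a + 1\<close>. Each change costs at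
  most one unit at a neighbouring node, and the gain there pays for it. The entry taken out has to
  be put back where no string feels it: an old string at node \<open>a\<close> has length at most
  c_a, so the value c_a + 1 is harmless. For e_a the same length bound at node \<open>a + 1\<close>
  allows the largest entry of column \<open>a + 1\<close> to be moved down.\<close>

definition cnt :: "nat set \<Rightarrow> nat \<Rightarrow> int" where
  "cnt A i = int (card (A \<inter> {..i}))"

lemma cnt_Suc: "cnt A (Suc i) = cnt A i + of_bool (Suc i \<in> A)"
proof (cases "Suc i \<in> A")
  case True
  then have "A \<inter> {..Suc i} = insert (Suc i) (A \<inter> {..i})"
    by (auto simp: atMost_Suc)
  then show ?thesis using True by (simp add: cnt_def)
next
  case False
  then have "A \<inter> {..Suc i} = A \<inter> {..i}"
    by (auto simp: atMost_Suc)
  then show ?thesis using False by (simp add: cnt_def)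
qed

lemma cnt_insert: "s \<notin> A \<Longrightarrow> cnt (insert s A) i = cnt A i + of_bool (s \<le> i)"
  by (simp add: cnt_def Int_insert_left)

lemma cnt_remove: "s \<in> A \<Longrightarrow> cnt (A - {s}) i = cnt A i - of_bool (s \<le> i)"
  using cnt_insert[of s "A - {s}" i] by (simp add: insert_absorb)

lemma cnt_empty [simp]: "cnt {} i = 0"
  by (simp add: cnt_def)

lemma cnt_zero: "0 \<notin> A \<Longrightarrow> cnt A 0 = 0"
  by (simp add: cnt_def)

lemma cnt_nonneg: "0 \<le> cnt A i"
  by (simp add: cnt_def)

lemma cnt_mono: "i \<le> j \<Longrightarrow> cnt A i \<le> cnt A j"
  unfolding cnt_def by (simp, intro card_mono) auto

lemma cnt_lipschitz: "i \<le> j \<Longrightarrow> cnt A j \<le> cnt A i + (int j - int i)"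
  by (induction j rule: dec_induct) (auto simp: cnt_Suc)

lemma cnt_full: "i \<le> j \<Longrightarrow> {i<..j} \<subseteq> A \<Longrightarrow> cnt A j = cnt A i + (int j - int i)"
proof (induction j rule: dec_induct)
  case (step k)
  then have "{i<..k} \<subseteq> A" "Suc k \<in> A" by auto
  then show ?case using step by (simp add: cnt_Suc)
qed simp

lemma cnt_const: "i \<le> j \<Longrightarrow> {i<..j} \<inter> A = {} \<Longrightarrow> cnt A j = cnt A i"
proof (induction j rule: dec_induct)
  case (step k)
  have "{i<..k} \<subseteq> {i<..Suc k}" "Suc k \<in> {i<..Suc k}" using step.hyps by auto
  then have "{i<..k} \<inter> A = {}" "Suc k \<notin> A" using step.prems by blast+
  then show ?case using step by (simp add: cnt_Suc)
qed simp

lemma cnt_eq_card: "A \<subseteq> {1..c} \<Longrightarrow> c \<le> i \<Longrightarrow> cnt A i = int (card A)"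
  unfolding cnt_def by (intro arg_cong[of _ _ "\<lambda>X. int (card X)"]) auto

lemma cnt_interval: "cnt {1..c} i = int (min i c)"
proof -
  have "{1..c} \<inter> {..i} = {1..min i c}" by auto
  then show ?thesis by (simp add: cnt_def)
qed

text \<open>Here \<open>A\<close> and \<open>B\<close> are columns \<open>a\<close> and \<open>a + 1\<close> of a tableau and \<open>f_op\<close> lengthens a string
  of length \<open>l\<close> and label \<open>x\<close>. The first gap \<open>s\<close> of \<open>A\<close> beyond \<open>l\<close> is filled. The first entry
  beyond \<open>l\<close> of \<open>B\<close> that violates the new bound, if any, is moved to \<open>c + 1\<close>, the value
  that becomes available when column \<open>a\<close> gets longer.\<close>

lemma raise_columns:
  fixes A B :: "nat set" and x :: int
  assumes fin: "finite A" and B: "B \<subseteq> {1..c}" and l: "l \<le> c" and Dl: "cnt B l - cnt A l \<le> x"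
    and s: "l < s" "s \<notin> A" "{l<..<s} \<subseteq> A"
  obtains B' where "B' \<subseteq> {1..c + 1}" "card B' = card B"
    "\<And>i. cnt B i - of_bool (l < i) \<le> cnt B' i"
    "cnt B' (l + 1) - cnt (insert s A) (l + 1) \<le> x - 1"
    "\<And>i. i \<le> l \<Longrightarrow> cnt B' i - cnt (insert s A) i \<le> cnt B i - cnt A i"
    "\<And>i y. \<lbrakk>l < i; i \<le> c; x + 1 \<le> y; cnt B i - cnt A i \<le> y\<rbrakk>
       \<Longrightarrow> cnt B' i - cnt (insert s A) i \<le> y - 2"
proof -
  define D where "D i = cnt B i - cnt A i" for i
  \<comment> \<open>Between \<open>l\<close> and \<open>s\<close> the new entry \<open>s\<close>
    does not count yet; the run of entries of \<open>A\<close> lowers \<open>D\<close> to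
    \<open>x - 1\<close>, and an entry of \<open>B\<close> may cancel that. From \<open>s\<close> on
    the insertion gives one unit, so trouble starts only with \<open>D\<close> at
    \<open>x + 1\<close>.\<close>
  define V where "V = {u \<in> B. l < u \<and> (u < s \<or> x + 1 \<le> D u)}"
  have D_Suc: "D (Suc i) = D i + of_bool (Suc i \<in> B) - of_bool (Suc i \<in> A)" for i
    by (simp add: D_def cnt_Suc)
  have below: "D i \<le> x \<and> (l < i \<and> i < s \<longrightarrow> D i \<le> x - 1)"
    if "l \<le> i" "\<forall>u\<in>V. i < u" for i
    using that
  proof (induction i rule: dec_induct)
    case base
    then show ?case using Dl by (simp add: D_def)
  next
    case (step i)
    then have IH: "D i \<le> x" and notV: "Suc i \<notin> V" by (force, blast)
    have "Suc i < s \<Longrightarrow> Suc i \<in> A \<and> Suc i \<notin> B"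
      using s(3) notV step.hyps by (auto simp: V_def)
    moreover have "\<not> x + 1 \<le> D (Suc i) \<or> Suc i \<notin> B"
      using notV step.hyps by (auto simp: V_def)
    ultimately show ?case using IH D_Suc[of i] by (auto split: if_splits)
  qed
  \<comment> \<open>Below \<open>s\<close> every step adds to \<open>A\<close>, so \<open>D\<close>
    cannot rise whatever \<open>B\<close> contains. This serves the lengths between \<open>u\<close>
    and \<open>s\<close>, where the removal of \<open>u\<close> is the only help.\<close>
  have early: "D i \<le> x" if "l \<le> i" "i < s" for i
    using that
  proof (induction i rule: dec_induct)
    case base
    then show ?case using Dl by (simp add: D_def)
  next
    case (step i)
    then have "Suc i \<in> A" using s(3) by auto
    then show ?case using step D_Suc[of i] by simp
  qed
  have cA: "cnt (insert s A) i = cnt A i + of_bool (s \<le> i)" for i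
    using s(2) by (rule cnt_insert)
  show ?thesis
  proof (cases "V = {}")
    case True
    show ?thesis
    proof (rule that[of B])
      show "cnt B (l + 1) - cnt (insert s A) (l + 1) \<le> x - 1"
        using below[of "l + 1"] True s(1) by (auto simp: cA D_def)
      show "cnt B i - cnt (insert s A) i \<le> y - 2"
        if "l < i" "i \<le> c" "x + 1 \<le> y" "cnt B i - cnt A i \<le> y" for i y
        using below[of i] True that by (auto simp: cA D_def)
    qed (use B in \<open>auto simp: cA\<close>)
  next
    case False
    define u where "u = (LEAST u. u \<in> V)"
    have u: "u \<in> V" using False unfolding u_def by (auto intro: LeastI)
    have u_min: "i < u \<Longrightarrow> \<forall>v\<in>V. i < v" for i
      unfolding u_def by (meson Least_le order_less_le_trans)
    have uB: "u \<in> B" "l < u" "u \<le> c" using u B by (auto simp: V_def)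
    have fB: "finite B" using B finite_subset by blast
    have c1: "Suc c \<notin> B - {u}" using B by auto
    let ?B = "insert (Suc c) (B - {u})"
    have cB: "cnt ?B i = cnt B i - of_bool (u \<le> i) + of_bool (Suc c \<le> i)" for i
      using cnt_insert[OF c1] cnt_remove[OF uB(1)] by simp
    show ?thesis
    proof (rule that[of ?B])
      show "?B \<subseteq> {1..c + 1}" using B by auto
      show "card ?B = card B"
        using c1 uB(1) fB by (simp add: card_insert_disjoint card_Suc_Diff1 del: card_Diff_insert)
      show "cnt B i - of_bool (l < i) \<le> cnt ?B i" for i
        unfolding cB using uB by auto
      show "cnt ?B (l + 1) - cnt (insert s A) (l + 1) \<le> x - 1"
      proof (cases "l + 1 < u")
        case True
        then show ?thesis
          using below[of "l + 1"] u_min[of "l + 1"] uB s(1) by (auto simp: cA cB D_def)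
      next
        case False
        \<comment> \<open>If also \<open>s = l + 1\<close>, then \<open>D\<close> may be
          \<open>x + 1\<close> here but both changes count; otherwise \<open>early\<close> gives
          \<open>x\<close>, and the removal of \<open>u\<close> suffices.\<close>
        then have "u = l + 1" using uB by simp
        moreover have "D (l + 1) \<le> x + 1"
          using D_Suc[of l] Dl by (auto simp: D_def)
        ultimately show ?thesis
          using early[of "l + 1"] s(1) uB(3) unfolding cA cB
          by (cases "l + 1 < s") (simp_all add: D_def)
      qed
      show "cnt ?B i - cnt (insert s A) i \<le> cnt B i - cnt A i" if "i \<le> l" for i
        using that uB l s(1) by (simp add: cA cB)
      show "cnt ?B i - cnt (insert s A) i \<le> y - 2"
        if "l < i" "i \<le> c" "x + 1 \<le> y" "cnt B i - cnt A i \<le> y" for i y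
        using below[of i] u_min[of i] early[of i] that
        by (cases "i < u"; cases "i < s") (auto simp: cA cB D_def)
    qed
  qed
qed

text \<open>The counterpart for \<open>e_op\<close>: \<open>s\<close> is the last entry of \<open>A\<close> up to \<open>l\<close>, and the largest entry
  of \<open>B\<close> is moved to the last gap \<open>u\<close> of \<open>B\<close> up to \<open>l\<close>, unless it is already below \<open>u\<close>.\<close>

lemma lower_columns:
  fixes A B :: "nat set" and x :: int
  assumes A: "finite A" "0 \<notin> A" and B: "B \<subseteq> {1..card A}" and l: "1 \<le> l" "l \<le> card A"
    and Dl: "cnt B l - cnt A l \<le> x" and x: "x \<le> -1"
  obtains s B' where "s \<in> A" "s \<le> l" "B' \<subseteq> {1..card A - 1}" "card B' = card B"
    "\<And>i. i \<le> card B \<Longrightarrow> cnt B i + of_bool (l \<le> i) \<le> cnt B' i"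
    "\<And>i. l \<le> i \<Longrightarrow> cnt B' i - (cnt A i - of_bool (s \<le> i)) \<le> cnt B i - cnt A i + 2"
    "\<And>i. i < l \<Longrightarrow> cnt B' i - (cnt A i - of_bool (s \<le> i)) \<le> max (cnt B i - cnt A i) (x + 1)"
    "cnt B' (l - 1) - (cnt A (l - 1) - of_bool (s \<le> l - 1)) \<le> x + 1"
proof -
  have B0: "0 \<notin> B" using B by auto
  have fB: "finite B" using B finite_subset by blast
  have "A \<inter> {..l} \<noteq> {}"
  proof
    assume "A \<inter> {..l} = {}"
    then have "cnt A l = 0" by (simp add: cnt_def)
    then show False using Dl x cnt_nonneg[of B l] by linarith
  qed
  define s where "s = Max (A \<inter> {..l})"
  have s: "s \<in> A" "s \<le> l" "{s<..l} \<inter> A = {}"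
  proof -
    have "s \<in> A \<inter> {..l}" unfolding s_def by (rule Max_in) (use \<open>A \<inter> {..l} \<noteq> {}\<close> in auto)
    then show "s \<in> A" "s \<le> l" by auto
    have "i \<le> s" if "i \<in> A" "i \<le> l" for i
      unfolding s_def by (rule Max_ge) (use that in auto)
    then show "{s<..l} \<inter> A = {}" by force
  qed
  have "{1..l} - B \<noteq> {}"
  proof
    assume "{1..l} - B = {}"
    then have "{0<..l} \<subseteq> B" by auto
    then have "cnt B l = int l" using cnt_full[of 0 l B] cnt_zero[OF B0] by simp
    moreover have "cnt A l \<le> int l" using cnt_lipschitz[of 0 l A] cnt_zero[OF A(2)] by simp
    ultimately show False using Dl x by linarith
  qed
  define u where "u = Max ({1..l} - B)"
  have u: "1 \<le> u" "u \<le> l" "u \<notin> B" "{u<..l} \<subseteq> B"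
  proof -
    have "u \<in> {1..l} - B" unfolding u_def by (rule Max_in) (use \<open>{1..l} - B \<noteq> {}\<close> in auto)
    then show "1 \<le> u" "u \<le> l" "u \<notin> B" by auto
    have "i \<le> u" if "1 \<le> i" "i \<le> l" "i \<notin> B" for i
      unfolding u_def by (rule Max_ge) (use that in auto)
    then have "i \<in> B" if "u < i" "i \<le> l" for i
      using that \<open>1 \<le> u\<close> by (meson le_trans less_imp_le not_le)
    then show "{u<..l} \<subseteq> B" by auto
  qed
  have A_late: "cnt A i = cnt A l" if "s \<le> i" "i \<le> l" for i
  proof (rule cnt_const[symmetric])
    have "{i<..l} \<subseteq> {s<..l}" using that by auto
    then show "{i<..l} \<inter> A = {}" using s(3) by blast
  qed (rule that)
  have B_late: "cnt B l = cnt B i + (int l - int i)" if "u \<le> i" "i \<le> l" for i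
    by (rule cnt_full) (use that u(4) in auto)
  \<comment> \<open>Compare with length \<open>l\<close>: \<open>A\<close> has no entry between
    \<open>s\<close> and \<open>l\<close>, while the count of \<open>B\<close> rises at each step
    from \<open>u\<close> to \<open>l\<close>. Going down from \<open>l\<close>, one of the two
    always leaves room for the units lost or added by the move.\<close>
  have E: "cnt B i + of_bool (u \<le> i) - (cnt A i - of_bool (s \<le> i)) \<le> x + 1"
    if "i < l" "s \<le> i \<or> u \<le> i" for i
  proof (cases "s \<le> i")
    case True
    then show ?thesis
      using A_late[of i] B_late[of i] cnt_mono[of i l B] that Dl by (cases "u \<le> i") auto
  next
    case False
    then show ?thesis
      using A_late[of s] B_late[of i] cnt_lipschitz[of i s A] that Dl s(2) by auto
  qed
  have E_last: "cnt B (l - 1) + of_bool (u \<le> l - 1) - (cnt A (l - 1) - of_bool (s \<le> l - 1)) \<le> x + 1"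
  proof (cases "s \<le> l - 1 \<or> u \<le> l - 1")
    case True
    then show ?thesis using E[of "l - 1"] l(1) by simp
  next
    case False
    \<comment> \<open>Neither change is visible at \<open>l - 1\<close>; but \<open>l\<close> is in
      \<open>A\<close> and not in \<open>B\<close>, so the old difference at \<open>l - 1\<close>
      exceeds that at \<open>l\<close> by one.\<close>
    then have "s = l" "u = l" using s u by auto
    then show ?thesis
      using cnt_Suc[of B "l - 1"] cnt_Suc[of A "l - 1"] l(1) s u Dl by auto
  qed
  have "\<exists>B'. B' \<subseteq> {1..card A - 1} \<and> card B' = card B \<and>
      (\<forall>i \<le> card B. cnt B i + of_bool (l \<le> i) \<le> cnt B' i) \<and>
      (\<forall>i. cnt B' i \<le> cnt B i + of_bool (u \<le> i))"
  proof (cases "\<exists>v\<in>B. u < v")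
    case True
    define v where "v = Max B"
    have v: "v \<in> B" "u < v" "\<And>w. w \<in> B \<Longrightarrow> w \<le> v"
    proof -
      have "B \<noteq> {}" using True by auto
      then show "v \<in> B" "u < v" using True fB by (auto simp: v_def Max_gr_iff)
      show "w \<le> v" if "w \<in> B" for w using fB that by (simp add: v_def)
    qed
    \<comment> \<open>Since \<open>B\<close> misses \<open>u\<close> below its maximum
      \<open>v\<close>, that maximum exceeds \<open>card B\<close>. Hence no length up to
      \<open>card B\<close> notices that \<open>v\<close> has gone.\<close>
    have "B \<subseteq> {1..v} - {u}" using v(3) B u(3) by force
    then have "card B \<le> card ({1..v} - {u})" by (intro card_mono) auto
    then have v_large: "card B < v" using u v by simp
    have u': "u \<notin> B - {v}" using u by simp
    let ?B = "insert u (B - {v})"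
    have cB: "cnt ?B i = cnt B i + of_bool (u \<le> i) - of_bool (v \<le> i)" for i
      using cnt_insert[OF u'] cnt_remove[OF v(1)] by simp
    have "v \<le> card A" using v(1) B by auto
    have "?B \<subseteq> {1..card A - 1}"
    proof
      fix w assume "w \<in> ?B"
      then have "1 \<le> w" "w < v" using u(1) v(2) v(3)[of w] B by auto
      then show "w \<in> {1..card A - 1}" using \<open>v \<le> card A\<close> by auto
    qed
    moreover have "card ?B = card B"
      using u' v(1) fB by (simp add: card_insert_disjoint card_Suc_Diff1 del: card_Diff_insert)
    ultimately show ?thesis
      using v_large u by (intro exI[of _ ?B]) (auto simp: cB)
  next
    case False
    \<comment> \<open>With all of \<open>B\<close> below \<open>u\<close> there are fewer than
      \<open>l\<close> entries, so the gain demanded from \<open>l\<close> on concerns no length up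
      to \<open>card B\<close>, and \<open>B\<close> can stay.\<close>
    then have lt: "w < u" if "w \<in> B" for w
      using that u(3) by (metis linorder_neqE_nat)
    then have "B \<subseteq> {1..u - 1}" using B by force
    then have "card B \<le> card {1..u - 1}" by (intro card_mono) auto
    then have "card B < l" using u l by simp
    moreover have "B \<subseteq> {1..card A - 1}" using \<open>B \<subseteq> {1..u - 1}\<close> u l by force
    ultimately show ?thesis by (intro exI[of _ B]) auto
  qed
  then obtain B' where B': "B' \<subseteq> {1..card A - 1}" "card B' = card B"
      "\<And>i. i \<le> card B \<Longrightarrow> cnt B i + of_bool (l \<le> i) \<le> cnt B' i"
      "\<And>i. cnt B' i \<le> cnt B i + of_bool (u \<le> i)"
    by blast
  show ?thesis
  proof (rule that[OF s(1,2) B'(1,2,3)])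
    show "cnt B' i - (cnt A i - of_bool (s \<le> i)) \<le> cnt B i - cnt A i + 2" if "l \<le> i" for i
      using B'(4)[of i] by (cases "s \<le> i"; cases "u \<le> i") auto
    show "cnt B' i - (cnt A i - of_bool (s \<le> i)) \<le> max (cnt B i - cnt A i) (x + 1)" if "i < l" for i
      using B'(4)[of i] E[of i] that by (cases "s \<le> i"; cases "u \<le> i") (auto simp: max_def)
    show "cnt B' (l - 1) - (cnt A (l - 1) - of_bool (s \<le> l - 1)) \<le> x + 1"
      using B'(4)[of "l - 1"] E_last by linarith
  qed
qed


section \<open>Vacancy numbers\<close>

text \<open>The number of boxes in the first \<open>i\<close> columns of the Young diagram of
  \<open>M\<close>: concave in \<open>i\<close>, with kinks only at the part lengths.\<close>

definition trunc_size :: "nat multiset \<Rightarrow> nat \<Rightarrow> int" where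
  "trunc_size M i = (\<Sum>j\<in>#M. int (min i j))"

lemma trunc_size_add [simp]: "trunc_size (M + N) i = trunc_size M i + trunc_size N i"
  by (simp add: trunc_size_def)

lemma trunc_size_single [simp]: "trunc_size {#j#} i = int (min i j)"
  by (simp add: trunc_size_def)

lemma trunc_size_empty [simp]: "trunc_size {#} i = 0"
  by (simp add: trunc_size_def)

lemma trunc_size_add_mset [simp]: "trunc_size (add_mset j M) i = int (min i j) + trunc_size M i"
  by (simp add: trunc_size_def)

lemma trunc_size_zero [simp]: "trunc_size M 0 = 0"
  by (induction M) auto

lemma trunc_size_mono: "i \<le> k \<Longrightarrow> trunc_size M i \<le> trunc_size M k"
  by (induction M) auto

lemma trunc_size_le: "trunc_size M i \<le> int (sum_mset M)"
  by (induction M) auto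

lemma trunc_size_eq: "(\<And>j. j \<in># M \<Longrightarrow> j \<le> i) \<Longrightarrow> trunc_size M i = int (sum_mset M)"
  by (induction M) auto

lemma min_concave: "int (min i j) + int (min (Suc (Suc i)) j) \<le> 2 * int (min (Suc i) j)"
  by (auto simp: min_def)

lemma trunc_size_concave: "trunc_size M i + trunc_size M (Suc (Suc i)) \<le> 2 * trunc_size M (Suc i)"
proof (induction M)
  case (add x M)
  then show ?case using min_concave[of i x] by (simp del: of_nat_min)
qed simp

lemma trunc_size_linear:
  "Suc i \<notin># M \<Longrightarrow> trunc_size M i + trunc_size M (Suc (Suc i)) = 2 * trunc_size M (Suc i)"
  by (induction M) (auto simp: min_def)

lemma sum_set_mset_count:
  fixes h :: "'a \<Rightarrow> int"
  shows "(\<Sum>j\<in>set_mset M. h j * int (count M j)) = (\<Sum>j\<in>#M. h j)"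
proof -
  \<comment> \<open>The index set is generalized to a fixed finite superset, since
    \<open>set_mset M\<close> itself changes along the induction.\<close>
  have "(\<Sum>j\<in>#M. h j) = (\<Sum>j\<in>A. h j * int (count M j))" if "finite A" "set_mset M \<subseteq> A" for A
    using that(2)
  proof (induction M)
    case (add x M)
    have "(\<Sum>i\<in>A. h i * int (count (add_mset x M) i))
        = (\<Sum>i\<in>A. h i * int (count M i) + (if x = i then h i else 0))"
      by (rule sum.cong) (auto simp: algebra_simps)
    also have "\<dots> = (\<Sum>j\<in>#M. h j) + h x"
      using add that(1) by (simp add: sum.distrib)
    finally show ?case by simp
  qed simp
  from this[of "set_mset M"] show ?thesis by simp
qed

lemma sum_supp_mset:
  fixes h :: "nat \<Rightarrow> nat \<Rightarrow> int"
  assumes "partition_seq n \<nu>"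
  shows "(\<Sum>(b, j)\<in>supp n (num_parts \<nu>). h b j * int (num_parts \<nu> b j)) = (\<Sum>b\<in>idx n. \<Sum>j\<in>#\<nu> b. h b j)"
proof -
  have "set_mset (\<nu> b) - {0} = set_mset (\<nu> b)" if "b \<in> idx n" for b
    using assms that by (auto simp: partition_seq_def)
  then show ?thesis
    unfolding supp_num_parts num_parts_def
    by (subst sum.Sigma[symmetric]) (auto simp: idx_def sum_set_mset_count)
qed

definition local_term :: "(nat \<Rightarrow> nat \<Rightarrow> nat) \<Rightarrow> nat \<Rightarrow> nat \<Rightarrow> int" where
  "local_term L a i = (\<Sum>j | 1 \<le> j \<and> L a j \<noteq> 0. int (min i j) * int (L a j))"

lemma vacancy_sum:
  assumes "partition_seq n \<nu>"
  shows "vacancy n L \<nu> a i = local_term L a i - (\<Sum>b\<in>idx n. trunc_size (\<nu> b) i * cartan b a)"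
proof -
  have "(\<Sum>(b, j)\<in>supp n (num_parts \<nu>). cartan a b * int (min i j) * int (num_parts \<nu> b j))
      = (\<Sum>b\<in>idx n. \<Sum>j\<in>#\<nu> b. cartan a b * int (min i j))"
    by (rule sum_supp_mset[OF assms])
  also have "\<dots> = (\<Sum>b\<in>idx n. trunc_size (\<nu> b) i * cartan b a)"
  proof (rule sum.cong[OF refl])
    fix b
    have "cartan a b = cartan b a" by (auto simp: cartan_def)
    then show "(\<Sum>j\<in>#\<nu> b. cartan a b * int (min i j)) = trunc_size (\<nu> b) i * cartan b a"
      by (simp add: trunc_size_def sum_mset_distrib_left mult.commute)
  qed
  finally show ?thesis by (simp add: vacancy_def local_term_def)
qed

lemma vacancy_eq:
  assumes "partition_seq n \<nu>" "a \<in> idx n"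
  shows "vacancy n L \<nu> a i = local_term L a i - 2 * trunc_size (\<nu> a) i
    + trunc_size (\<nu> (a - 1)) i + trunc_size (\<nu> (a + 1)) i"
proof -
  have "\<nu> 0 = {#}" "\<nu> n = {#}" using assms(1) by (auto simp: partition_seq_def idx_def)
  then show ?thesis
    using cartan_sum[of a n "\<lambda>b. trunc_size (\<nu> b) i"] assms
    by (simp add: vacancy_sum[OF assms(1)])
qed

lemma vacancy_update:
  assumes "partition_seq n \<nu>" "partition_seq n \<nu>'" "a \<in> idx n" "\<And>b. b \<noteq> a \<Longrightarrow> \<nu>' b = \<nu> b"
    and "trunc_size (\<nu>' a) i = trunc_size (\<nu> a) i + d"
  shows "vacancy n L \<nu>' b i = vacancy n L \<nu> b i - cartan a b * d"
proof -
  have "(\<Sum>c\<in>idx n. trunc_size (\<nu>' c) i * cartan c b)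
      = trunc_size (\<nu>' a) i * cartan a b + (\<Sum>c\<in>idx n - {a}. trunc_size (\<nu>' c) i * cartan c b)"
    using assms(3) by (intro sum.remove) (auto simp: idx_def)
  also have "(\<Sum>c\<in>idx n - {a}. trunc_size (\<nu>' c) i * cartan c b)
      = (\<Sum>c\<in>idx n - {a}. trunc_size (\<nu> c) i * cartan c b)"
    using assms(4) by (intro sum.cong) auto
  also have "trunc_size (\<nu>' a) i * cartan a b + \<dots>
      = cartan a b * d + (trunc_size (\<nu> a) i * cartan a b + \<dots>)"
    using assms(5) by (simp add: algebra_simps)
  also have "trunc_size (\<nu> a) i * cartan a b + (\<Sum>c\<in>idx n - {a}. trunc_size (\<nu> c) i * cartan c b)
      = (\<Sum>c\<in>idx n. trunc_size (\<nu> c) i * cartan c b)"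
    using assms(3) by (intro sum.remove[symmetric]) (auto simp: idx_def)
  finally show ?thesis by (simp add: vacancy_sum assms)
qed

section \<open>Weights and column sizes\<close>

definition local_size :: "(nat \<Rightarrow> nat \<Rightarrow> nat) \<Rightarrow> nat \<Rightarrow> int" where
  "local_size L a = (\<Sum>j | 1 \<le> j \<and> L a j \<noteq> 0. int j * int (L a j))"

lemma local_term_mono: "i \<le> k \<Longrightarrow> local_term L a i \<le> local_term L a k"
  unfolding local_term_def by (intro sum_mono mult_right_mono) auto

lemma local_term_le: "local_term L a i \<le> local_size L a"
  unfolding local_term_def local_size_def by (intro sum_mono mult_right_mono) auto

lemma local_term_concave:
  "local_term L a i + local_term L a (Suc (Suc i)) \<le> 2 * local_term L a (Suc i)"
  unfolding local_term_def sum.distrib[symmetric] sum_distrib_left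
proof (intro sum_mono)
  fix j
  have "(int (min i j) + int (min (Suc (Suc i)) j)) * int (L a j) \<le> 2 * int (min (Suc i) j) * int (L a j)"
    by (rule mult_right_mono[OF min_concave]) simp
  then show "int (min i j) * int (L a j) + int (min (Suc (Suc i)) j) * int (L a j)
      \<le> 2 * (int (min (Suc i) j) * int (L a j))"
    by (simp only: distrib_right mult.assoc)
qed

lemma sum_supp_fund_weight:
  assumes L: "multiplicity_array n L" and "b \<in> idx n"
  shows "(\<Sum>(a, i)\<in>supp n L. int i * int (L a i) * fund_weight a b) = local_size L b"
proof -
  have "(\<Sum>(a, i)\<in>supp n L. int i * int (L a i) * fund_weight a b)
      = (\<Sum>(a, i)\<in>Pair b ` {j. 1 \<le> j \<and> L b j \<noteq> 0}. int i * int (L a i) * fund_weight a b)"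
    using assms
    by (intro sum.mono_neutral_right)
       (auto simp: supp_def nodes_def multiplicity_array_def fund_weight_def)
  also have "\<dots> = local_size L b"
    by (subst sum.reindex) (auto simp: inj_on_def fund_weight_def local_size_def)
  finally show ?thesis .
qed

text \<open>Coordinate \<open>a\<close> of the weight; also the value that the vacancy number at
  \<open>a\<close> reaches for large \<open>i\<close>.\<close>

definition node_weight :: "(nat \<Rightarrow> nat \<Rightarrow> nat) \<Rightarrow> (nat \<Rightarrow> nat multiset) \<Rightarrow> nat \<Rightarrow> int" where
  "node_weight L \<nu> a = local_size L a - 2 * int (sum_mset (\<nu> a))
     + int (sum_mset (\<nu> (a - 1))) + int (sum_mset (\<nu> (a + 1)))"

lemma wt_eq:
  assumes L: "multiplicity_array n L" and "partition_seq n (shape rc)"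
  shows "wt n L rc b = (if b \<in> idx n then node_weight L (shape rc) b else 0)"
proof (cases "b \<in> idx n")
  case True
  have "shape rc 0 = {#}" "shape rc n = {#}" using assms(2) by (auto simp: partition_seq_def idx_def)
  then show ?thesis
    using True cartan_sum[of b n "\<lambda>a. int (sum_mset (shape rc a))"]
    by (simp add: wt_def sum_supp_fund_weight[OF L] sum_supp_num_parts simple_root_apply node_weight_def
        del: of_nat_sum_mset)
next
  case False
  have "(\<Sum>(a, i)\<in>supp n L. int i * int (L a i) * fund_weight a b) = 0"
    using False by (intro sum.neutral) (auto simp: supp_def nodes_def fund_weight_def)
  moreover have "simple_root n a b = 0" for a
    unfolding simple_root_def using False by (intro sum.neutral) (auto simp: fund_weight_def)
  ultimately show ?thesis using False by (simp add: wt_def case_prod_beta)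
qed

lemma shape_in_configs_iff:
  "shape rc \<in> configs n L \<Lambda> \<longleftrightarrow> partition_seq n (shape rc) \<and> wt n L rc = \<Lambda>"
  by (auto simp: configs_def wt_def fun_eq_iff algebra_simps)

text \<open>The numbers \<open>c\<^sub>a\<close> of the paper, recovered from the shape: with \<open>col_size \<nu> n = 0\<close> they
  are determined by the weight, because their second differences are its coordinates.\<close>

definition col_size :: "nat \<Rightarrow> (nat \<Rightarrow> nat \<Rightarrow> nat) \<Rightarrow> (nat \<Rightarrow> nat multiset) \<Rightarrow> nat \<Rightarrow> nat" where
  "col_size n L \<nu> a = sum_mset (\<nu> a) + (\<Sum>(b, i)\<in>supp n L. i * L b i * (b - a))"

lemma col_size_ge: "sum_mset (\<nu> a) \<le> col_size n L \<nu> a"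
  by (simp add: col_size_def)

lemma col_size_last: "partition_seq n \<nu> \<Longrightarrow> col_size n L \<nu> n = 0"
  by (auto simp: col_size_def partition_seq_def supp_def nodes_def idx_def intro!: sum.neutral)

text \<open>Truncated subtraction makes \<open>b - a\<close> the positive part of the difference,
  whose second difference in \<open>a\<close> is 1 at \<open>b\<close> and 0 elsewhere. The
  correction term in \<open>col_size\<close> thus contributes exactly the \<open>L\<close> part of
  the weight.\<close>

lemma node_weight_eq:
  assumes L: "multiplicity_array n L" and "a \<in> idx n"
  shows "node_weight L \<nu> a
    = int (col_size n L \<nu> (a - 1)) - 2 * int (col_size n L \<nu> a) + int (col_size n L \<nu> (a + 1))"
proof -
  have a: "1 \<le> a" using assms by (simp add: idx_def)
  have *: "int (b - (a - 1)) - 2 * int (b - a) + int (b - (a + 1)) = of_bool (a = b)"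
    if "1 \<le> b" for b
    using that a by (cases "b < a"; cases "b = a") (auto simp: of_nat_diff)
  let ?g = "\<lambda>c. (\<Sum>(b, i)\<in>supp n L. i * L b i * (b - c))"
  have g: "int (?g c) = (\<Sum>(b, i)\<in>supp n L. int i * int (L b i) * int (b - c))" for c
    by (simp only: of_nat_sum case_prod_unfold of_nat_mult)
  have "int (?g (a - 1)) - 2 * int (?g a) + int (?g (a + 1))
      = (\<Sum>(b, i)\<in>supp n L. int i * int (L b i) * (int (b - (a - 1)) - 2 * int (b - a) + int (b - (a + 1))))"
    unfolding g sum_distrib_left sum_subtractf[symmetric] sum.distrib[symmetric]
    by (rule sum.cong[OF refl]) (simp only: case_prod_beta distrib_left right_diff_distrib mult.assoc mult.left_commute)
  also have "\<dots> = (\<Sum>(b, i)\<in>supp n L. int i * int (L b i) * fund_weight b a)"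
  proof (rule sum.cong[OF refl])
    fix z assume "z \<in> supp n L"
    then show "(case z of (b, i) \<Rightarrow> int i * int (L b i)
          * (int (b - (a - 1)) - 2 * int (b - a) + int (b - (a + 1))))
        = (case z of (b, i) \<Rightarrow> int i * int (L b i) * fund_weight b a)"
      using *[of "fst z"] by (auto simp: supp_def nodes_def idx_def fund_weight_def)
  qed
  also have "\<dots> = local_size L a" by (rule sum_supp_fund_weight[OF assms])
  finally show ?thesis by (simp add: node_weight_def col_size_def)
qed

section \<open>Concavity and growth of the vacancy numbers\<close>

lemma vacancy_0: "partition_seq n \<nu> \<Longrightarrow> vacancy n L \<nu> a 0 = 0"
  by (simp add: vacancy_sum local_term_def)

text \<open>The only term with a negative coefficient is the truncated size at \<open>a\<close>
  itself, and it is linear around a length that is not a part; all other terms are concave.\<close>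

lemma vacancy_concave:
  assumes "partition_seq n \<nu>" "a \<in> idx n" "Suc i \<notin># \<nu> a"
  shows "vacancy n L \<nu> a i + vacancy n L \<nu> a (Suc (Suc i)) \<le> 2 * vacancy n L \<nu> a (Suc i)"
proof -
  \<comment> \<open>Naming \<open>a - 1\<close> hides the truncated subtraction from the arithmetic
    procedure.\<close>
  define a' where "a' = a - 1"
  show ?thesis
    using local_term_concave[of L a i] trunc_size_linear[OF assms(3)]
      trunc_size_concave[of "\<nu> a'" i] trunc_size_concave[of "\<nu> (a + 1)" i]
    unfolding vacancy_eq[OF assms(1,2)] a'_def[symmetric] by smt
qed

text \<open>Past the longest part the negative term is constant, and the others only grow.\<close>

lemma vacancy_mono_after_parts:
  assumes "partition_seq n \<nu>" "a \<in> idx n" "\<And>j. j \<in># \<nu> a \<Longrightarrow> j \<le> i" "i \<le> k"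
  shows "vacancy n L \<nu> a i \<le> vacancy n L \<nu> a k"
proof -
  have "j \<le> k" if "j \<in># \<nu> a" for j using assms(3)[OF that] assms(4) by simp
  then have "trunc_size (\<nu> a) k = trunc_size (\<nu> a) i"
    using assms(3) by (simp add: trunc_size_eq)
  then show ?thesis
    using local_term_mono[OF assms(4), of L a] trunc_size_mono[OF assms(4), of "\<nu> (a - 1)"]
      trunc_size_mono[OF assms(4), of "\<nu> (a + 1)"]
    unfolding vacancy_eq[OF assms(1,2)] by (simp only:)
qed

text \<open>Past the longest part the negative term has reached its final value, while the positive
  ones are at most theirs.\<close>

lemma vacancy_le_node_weight:
  assumes "partition_seq n \<nu>" "a \<in> idx n" "\<And>j. j \<in># \<nu> a \<Longrightarrow> j \<le> i"
  shows "vacancy n L \<nu> a i \<le> node_weight L \<nu> a"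
proof -
  define a' where "a' = a - 1"
  show ?thesis
    using local_term_le[of L a i] trunc_size_eq[of "\<nu> a" i, OF assms(3)]
      trunc_size_le[of "\<nu> a'" i] trunc_size_le[of "\<nu> (a + 1)" i]
    unfolding vacancy_eq[OF assms(1,2)] node_weight_def a'_def[symmetric] by linarith
qed

text \<open>Between consecutive parts the vacancy numbers are concave, so the ends control the
  interior. The strict half leaves room for the string shortened by \<open>e_op\<close>; the weak
  half yields admissibility of highest weight elements.\<close>

lemma vacancy_ge_between:
  assumes \<nu>: "partition_seq n \<nu>" "a \<in> idx n"
    and "k < i" "i < m" "\<And>j. k < j \<Longrightarrow> j < m \<Longrightarrow> j \<notin># \<nu> a"
    and k: "z \<le> vacancy n L \<nu> a k" and m: "y \<le> vacancy n L \<nu> a m" "y \<le> z"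
  shows "y \<le> vacancy n L \<nu> a i \<and> (y < z \<longrightarrow> y < vacancy n L \<nu> a i)"
proof (rule ccontr)
  define p where "p = vacancy n L \<nu> a"
  define z' where "z' = (if y < z then y + 1 else y)"
  assume "\<not> ?thesis"
  then have i: "p i < z'" by (auto simp: p_def z'_def split: if_splits)
  \<comment> \<open>If \<open>p\<close> does not fall right after \<open>i\<close>, concavity makes
    it nondecreasing from \<open>k\<close> to \<open>i\<close>, and the deficit reaches the left
    end.\<close>
  have down: "p (i - d) < z' \<and> p (i - d) \<le> p (Suc (i - d))" if "d \<le> i - k" "p i \<le> p (Suc i)" for d
    using that(1)
  proof (induction d)
    case (Suc d)
    define r where "r = i - Suc d"
    have r: "i - d = Suc r" "k < Suc r" "Suc r < m" using Suc.prems assms(3,4) by (auto simp: r_def)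
    then have "p r + p (Suc (Suc r)) \<le> 2 * p (Suc r)"
      unfolding p_def using assms(5) by (intro vacancy_concave \<nu>) auto
    then show ?case using Suc unfolding r(1) r_def[symmetric] by linarith
  qed (use i that(2) in simp)
  have dec: "p (Suc i) < p i"
  proof (rule ccontr)
    assume "\<not> ?thesis"
    then have "p k < z'" using down[of "i - k"] assms(3) by simp
    then show False using k m(2) by (auto simp: p_def z'_def split: if_splits)
  qed
  \<comment> \<open>Otherwise \<open>p\<close> falls strictly all the way to \<open>m\<close>; the
    last step costs one more unit, which contradicts the bound at the right end.\<close>
  have up: "p (i + d) < z' \<and> p (Suc (i + d)) < p (i + d)" if "d < m - i" for d
    using that
  proof (induction d)
    case (Suc d)
    then have "p (i + d) + p (Suc (Suc (i + d))) \<le> 2 * p (Suc (i + d))"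
      unfolding p_def using assms(3,4,5) by (intro vacancy_concave \<nu>) auto
    then show ?case using Suc by simp
  qed (use i dec in simp)
  have "Suc (i + (m - i - 1)) = m" using assms(4) by simp
  then have "p m < z' - 1"
    using up[of "m - i - 1"] assms(4) by fastforce
  then show False using m by (auto simp: p_def z'_def split: if_splits)
qed


section \<open>The operators on strings\<close>

definition shift :: "(nat \<Rightarrow> int) \<Rightarrow> (nat \<times> int) multiset \<Rightarrow> (nat \<times> int) multiset" where
  "shift d M = image_mset (\<lambda>(i, x). (i, x + d i)) M"

lemma mem_shift: "(i, y) \<in># shift d M \<longleftrightarrow> (i, y - d i) \<in># M"
  by (force simp: shift_def)

lemma fst_shift: "image_mset fst (shift d M) = image_mset fst M"
  by (simp add: shift_def image_mset.compositionality o_def case_prod_unfold)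

lemma shift_shift: "shift d (shift d' M) = shift (\<lambda>i. d' i + d i) M"
  by (simp add: shift_def image_mset.compositionality o_def case_prod_unfold add.assoc)

lemma shift_zero: "shift (\<lambda>i. 0) M = M"
  by (simp add: shift_def case_prod_unfold)

lemma shape_replace:
  "shape (replace_strings n L a old new rc) b =
     (if b = a then image_mset fst (rc a - old) + image_mset fst new else shape rc b)"
  by (simp add: replace_strings_def Let_def shape_def image_mset.compositionality o_def case_prod_unfold)

text \<open>Keeping the colabel means adding the change of the vacancy number to the label. The
  result occurs on the right only through its shape, so the equation can be used as soon as the
  shape is known.\<close>

lemma replace_strings_eq:
  "replace_strings n L a old new rc b =
     shift (\<lambda>i. vacancy n L (shape (replace_strings n L a old new rc)) b i - vacancy n L (shape rc) b i)
       (if b = a then rc a - old else rc b) + (if b = a then new else {#})"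
proof -
  let ?rest = "rc(a := rc a - old)"
  have "shape (replace_strings n L a old new rc) = shape (?rest(a := ?rest a + new))"
    by (rule ext) (simp add: shape_replace, simp add: shape_def)
  then show ?thesis
    by (simp add: replace_strings_def Let_def shift_def algebra_simps)
qed

text \<open>The label shifts depend on the two shapes alone, so they cancel on the way back.\<close>

lemma replace_strings_inverse:
  assumes "old \<subseteq># rc a"
  shows "replace_strings n L a new old (replace_strings n L a old new rc) = rc" (is "?rc'' = rc")
proof -
  let ?rc' = "replace_strings n L a old new rc"
  have rest: "?rc' a - new = shift (\<lambda>i. vacancy n L (shape ?rc') a i - vacancy n L (shape rc) a i) (rc a - old)"
    by (subst replace_strings_eq) simp
  have "shape ?rc'' = shape rc"
  proof
    fix b
    have "image_mset fst (rc a - old) + image_mset fst old = image_mset fst (rc a)"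
      using assms by (simp flip: image_mset_union)
    then show "shape ?rc'' b = shape rc b"
      unfolding shape_replace[of n L a new old] rest fst_shift by (simp add: shape_replace) (simp add: shape_def)
  qed
  show ?thesis
  proof
    fix b
    show "?rc'' b = rc b"
    proof (cases "b = a")
      case True
      have "?rc'' a = shift (\<lambda>i. 0) (rc a - old) + old"
        by (subst replace_strings_eq) (simp add: rest \<open>shape ?rc'' = shape rc\<close> shift_shift)
      then show ?thesis using assms True by (simp add: shift_zero)
    next
      case False
      have "?rc'' b = shift (\<lambda>i. vacancy n L (shape rc) b i - vacancy n L (shape ?rc') b i) (?rc' b)"
        using False by (subst replace_strings_eq) (simp add: \<open>shape ?rc'' = shape rc\<close>)
      also have "?rc' b = shift (\<lambda>i. vacancy n L (shape ?rc') b i - vacancy n L (shape rc) b i) (rc b)"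
        using False by (subst replace_strings_eq) simp
      finally show ?thesis by (simp add: shift_shift shift_zero)
    qed
  qed
qed

text \<open>The remaining strings keep their colabels, and validity says that colabels are
  nonnegative; only the new strings have to be checked.\<close>

lemma valid_replace:
  assumes "valid n L rc"
    and "\<And>i y. (i, y) \<in># new \<Longrightarrow> y \<le> vacancy n L (shape (replace_strings n L a old new rc)) a i"
  shows "valid n L (replace_strings n L a old new rc)"
  unfolding valid_def
proof (intro ballI, safe)
  let ?rc' = "replace_strings n L a old new rc"
  fix b i y assume b: "b \<in> idx n" and "(i, y) \<in># ?rc' b"
  then consider "b = a" "(i, y) \<in># new"
    | "(i, y - (vacancy n L (shape ?rc') b i - vacancy n L (shape rc) b i)) \<in># rc b"
    by (subst (asm) replace_strings_eq) (auto simp: mem_shift dest: in_diffD split: if_splits)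
  then show "y \<le> vacancy n L (shape ?rc') b i"
  proof cases
    case 2
    then show ?thesis using assms(1) b by (fastforce simp: valid_def)
  qed (use assms(2) in simp)
qed

section \<open>The strings selected by the operators\<close>

definition string_if :: "nat \<Rightarrow> int \<Rightarrow> (nat \<times> int) multiset" where
  "string_if l x = (if l = 0 then {#} else {#(l, x)#})"

lemma in_shape: "(i, y) \<in># rc a \<Longrightarrow> i \<in># shape rc a"
  by (force simp: shape_def)

lemma partition_seq_pos: "partition_seq n (shape rc) \<Longrightarrow> (i, y) \<in># rc a \<Longrightarrow> 1 \<le> i"
  using in_shape[of i y rc a] by (cases "a \<in> idx n"; cases i) (auto simp: partition_seq_def)

lemma finite_labels: "finite {x. P x \<and> (\<exists>i. (i, x) \<in># M)}" for M :: "(nat \<times> int) multiset"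
  by (rule finite_subset[of _ "snd ` set_mset M"]) force+

lemma finite_lengths: "finite {i. (i, x) \<in># M}" for M :: "(nat \<times> int) multiset"
  by (rule finite_subset[of _ "fst ` set_mset M"]) force+

text \<open>If there is no string with nonpositive label, then \<open>f_op\<close> acts as if it had selected a
  string of length \<open>0\<close> and label \<open>0\<close>.\<close>

lemma f_op_elim:
  assumes part: "partition_seq n (shape rc)" and f: "f_op n L a rc = Some rc'"
  obtains l x where "rc' = replace_strings n L a (string_if l x) {#(l + 1, x - 1)#} rc"
    "valid n L rc'" "string_if l x \<subseteq># rc a" "x \<le> 0" "l = 0 \<Longrightarrow> x = 0"
    "\<And>i y. (i, y) \<in># rc a \<Longrightarrow> x \<le> y \<and> (l < i \<longrightarrow> x < y)"
proof -
  define X where "X = {x. x \<le> 0 \<and> (\<exists>i. (i, x) \<in># rc a)}"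
  have fin: "finite X" unfolding X_def by (rule finite_labels)
  show ?thesis
  proof (cases "X = {}")
    case True
    then have "rc' = replace_strings n L a {#} {#(1, -1)#} rc" "valid n L rc'"
      using f by (auto simp: f_op_def X_def[symmetric] Let_def split: if_splits)
    moreover have "0 < y" if "(i, y) \<in># rc a" for i y
      using True that by (auto simp: X_def simp flip: not_le)
    ultimately show ?thesis by (intro that[of 0 0]) (auto simp: string_if_def less_imp_le)
  next
    case False
    define x where "x = Min X"
    define l where "l = Max {i. (i, x) \<in># rc a}"
    have rc': "rc' = replace_strings n L a {#(l, x)#} {#(l + 1, x - 1)#} rc" "valid n L rc'"
      using f False by (auto simp: f_op_def X_def[symmetric] x_def l_def Let_def split: if_splits)
    have "x \<in> X" using False fin by (simp add: x_def)
    then have x: "x \<le> 0" "{i. (i, x) \<in># rc a} \<noteq> {}" by (auto simp: X_def)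
    have min: "x \<le> y" if "(i, y) \<in># rc a" for i y
    proof (cases "y \<le> 0")
      case True
      then show ?thesis unfolding x_def using that by (intro Min_le fin) (auto simp: X_def)
    qed (use x in simp)
    have "l \<in> {i. (i, x) \<in># rc a}" unfolding l_def using x finite_lengths by (intro Max_in) auto
    then have l: "(l, x) \<in># rc a" by simp
    have max: "i \<le> l" if "(i, x) \<in># rc a" for i
      unfolding l_def using that by (intro Max_ge finite_lengths) auto
    show ?thesis
    proof (rule that[of l x])
      show "x \<le> y \<and> (l < i \<longrightarrow> x < y)" if "(i, y) \<in># rc a" for i y
        using min[OF that] max[of i] that by (cases "x = y") auto
    qed (use rc' x l partition_seq_pos[OF part l] in \<open>auto simp: string_if_def\<close>)
  qed
qed

lemma f_op_intro:
  assumes sub: "string_if l x \<subseteq># rc a" and x: "x \<le> 0" "l = 0 \<Longrightarrow> x = 0"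
    and min: "\<And>i y. (i, y) \<in># rc a \<Longrightarrow> x \<le> y \<and> (l < i \<longrightarrow> x < y)"
    and pos: "\<And>i y. (i, y) \<in># rc a \<Longrightarrow> 1 \<le> i"
    and valid: "valid n L (replace_strings n L a (string_if l x) {#(l + 1, x - 1)#} rc)"
  shows "f_op n L a rc = Some (replace_strings n L a (string_if l x) {#(l + 1, x - 1)#} rc)"
proof -
  define X where "X = {x. x \<le> 0 \<and> (\<exists>i. (i, x) \<in># rc a)}"
  have fin: "finite X" unfolding X_def by (rule finite_labels)
  show ?thesis
  proof (cases "l = 0")
    case True
    \<comment> \<open>With \<open>l = 0\<close> every string is longer than \<open>l\<close>, so all
      labels are positive and \<open>f_op\<close> creates a string.\<close>
    have "0 < y" if "(i, y) \<in># rc a" for i y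
      using min[OF that] pos[OF that] x(2) True by simp
    then have "X = {}" by (force simp: X_def)
    then show ?thesis using valid True x(2) by (simp add: f_op_def X_def[symmetric] string_if_def)
  next
    case False
    then have l: "(l, x) \<in># rc a" using sub by (simp add: string_if_def)
    then have "Min X = x" using min x(1) by (intro Min_eqI fin) (auto simp: X_def)
    moreover have "Max {i. (i, x) \<in># rc a} = l"
    proof (intro Max_eqI finite_lengths)
      show "i \<le> l" if "i \<in> {i. (i, x) \<in># rc a}" for i
        using min[of i x] that by (auto simp: not_less[symmetric])
    qed (use l in simp)
    moreover have "X \<noteq> {}" using l x(1) by (auto simp: X_def)
    ultimately show ?thesis using valid False by (simp add: f_op_def X_def[symmetric] string_if_def Let_def)
  qed
qed

lemma e_op_elim:
  assumes e: "e_op n L a rc = Some rc'"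
  obtains l x where
    "rc' = replace_strings n L a {#(l, x)#} (if l = 1 then {#} else {#(l - 1, x + 1)#}) rc"
    "(l, x) \<in># rc a" "x < 0" "\<And>i y. (i, y) \<in># rc a \<Longrightarrow> x \<le> y \<and> (i < l \<longrightarrow> x < y)"
proof -
  define X where "X = {x. x < 0 \<and> (\<exists>i. (i, x) \<in># rc a)}"
  have fin: "finite X" unfolding X_def by (rule finite_labels)
  define x where "x = Min X"
  define l where "l = Min {i. (i, x) \<in># rc a}"
  have "X \<noteq> {}"
    using e by (auto simp: e_op_def X_def[symmetric] Let_def split: if_splits)
  then have "x \<in> X" using fin by (simp add: x_def)
  then have x: "x < 0" "{i. (i, x) \<in># rc a} \<noteq> {}" by (auto simp: X_def)
  have rc': "rc' = replace_strings n L a {#(l, x)#} (if l = 1 then {#} else {#(l - 1, x + 1)#}) rc"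
    using e \<open>X \<noteq> {}\<close> unfolding e_op_def X_def[symmetric] Let_def x_def[symmetric] l_def[symmetric]
    by simp
  have min: "x \<le> y" if "(i, y) \<in># rc a" for i y
  proof (cases "y < 0")
    case True
    then show ?thesis unfolding x_def using that by (intro Min_le fin) (auto simp: X_def)
  qed (use x in simp)
  have "l \<in> {i. (i, x) \<in># rc a}" unfolding l_def using x finite_lengths by (intro Min_in) auto
  then have l: "(l, x) \<in># rc a" by simp
  have min': "l \<le> i" if "(i, x) \<in># rc a" for i
    unfolding l_def using that by (intro Min_le finite_lengths) auto
  show ?thesis
  proof (rule that[OF rc' l x(1)])
    show "x \<le> y \<and> (i < l \<longrightarrow> x < y)" if "(i, y) \<in># rc a" for i y
      using min[OF that] min'[of i] that by (cases "x = y") auto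
  qed
qed

lemma e_op_None: "e_op n L a rc = None \<Longrightarrow> (i, x) \<in># rc a \<Longrightarrow> 0 \<le> x"
  unfolding e_op_def Let_def by (rule ccontr) (auto split: if_splits)

text \<open>One relation for both operators: \<open>f_op\<close> leads from the first shape to the
  second and \<open>e_op\<close> back. The value \<open>l = 0\<close> stands for the creation of a
  part of length 1.\<close>

definition grow :: "nat \<Rightarrow> nat \<Rightarrow> (nat \<Rightarrow> nat multiset) \<Rightarrow> (nat \<Rightarrow> nat multiset) \<Rightarrow> bool" where
  "grow a l \<nu> \<nu>' \<longleftrightarrow> (\<exists>R. \<nu> a = R + (if l = 0 then {#} else {#l#}) \<and> \<nu>' = \<nu>(a := add_mset (l + 1) R))"

lemma grow_trunc_size: "grow a l \<nu> \<nu>' \<Longrightarrow> trunc_size (\<nu>' a) i = trunc_size (\<nu> a) i + of_bool (l < i)"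
  by (auto simp: grow_def)

lemma grow_sum: "grow a l \<nu> \<nu>' \<Longrightarrow> sum_mset (\<nu>' b) = sum_mset (\<nu> b) + of_bool (b = a)"
  by (auto simp: grow_def)

lemma grow_other: "grow a l \<nu> \<nu>' \<Longrightarrow> b \<noteq> a \<Longrightarrow> \<nu>' b = \<nu> b"
  by (auto simp: grow_def)

lemma grow_partition_seq: "a \<in> idx n \<Longrightarrow> grow a l \<nu> \<nu>' \<Longrightarrow> partition_seq n \<nu>' \<longleftrightarrow> partition_seq n \<nu>"
  by (auto simp: grow_def partition_seq_def split: if_splits)

lemma grow_col_size: "grow a l \<nu> \<nu>' \<Longrightarrow> col_size n L \<nu>' b = col_size n L \<nu> b + of_bool (b = a)"
  by (simp add: col_size_def grow_sum)

lemma grow_vacancy: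
  assumes "grow a l \<nu> \<nu>'" "a \<in> idx n" "partition_seq n \<nu>"
  shows "vacancy n L \<nu>' b i = vacancy n L \<nu> b i - cartan a b * of_bool (l < i)"
proof (rule vacancy_update[OF assms(3) _ assms(2)])
  show "partition_seq n \<nu>'" using grow_partition_seq[OF assms(2,1)] assms(3) by simp
  show "\<nu>' c = \<nu> c" if "c \<noteq> a" for c using assms(1) that by (rule grow_other)
  show "trunc_size (\<nu>' a) i = trunc_size (\<nu> a) i + of_bool (l < i)"
    using assms(1) by (rule grow_trunc_size)
qed

lemma grow_replace_f:
  assumes "string_if l x \<subseteq># rc a"
  shows "grow a l (shape rc) (shape (replace_strings n L a (string_if l x) {#(l + 1, x')#} rc))"
  unfolding grow_def
proof (intro exI conjI)
  have "shape rc a = image_mset fst (rc a - string_if l x) + image_mset fst (string_if l x)"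
    using assms by (simp add: shape_def flip: image_mset_union)
  then show "shape rc a = image_mset fst (rc a - string_if l x) + (if l = 0 then {#} else {#l#})"
    by (simp add: string_if_def)
qed (rule ext, simp add: shape_replace)

lemma grow_replace_e:
  assumes "(l, x) \<in># rc a" "1 \<le> l"
  shows "grow a (l - 1)
    (shape (replace_strings n L a {#(l, x)#} (if l = 1 then {#} else {#(l - 1, x')#}) rc)) (shape rc)"
  unfolding grow_def
proof (intro exI conjI)
  show "shape (replace_strings n L a {#(l, x)#} (if l = 1 then {#} else {#(l - 1, x')#}) rc) a
      = image_mset fst (rc a - {#(l, x)#}) + (if l - 1 = 0 then {#} else {#l - 1#})"
    using assms(2) by (auto simp: shape_replace)
  have "shape rc a = add_mset l (image_mset fst (rc a - {#(l, x)#}))"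
    using arg_cong[OF insert_DiffM[OF assms(1)], of "image_mset fst"] by (simp add: shape_def)
  then show "shape rc = (shape (replace_strings n L a {#(l, x)#} (if l = 1 then {#} else {#(l - 1, x')#}) rc))
      (a := add_mset (l - 1 + 1) (image_mset fst (rc a - {#(l, x)#})))"
    using assms(2) by (intro ext) (simp add: shape_replace)
qed


section \<open>Characterization of the unrestricted rigged configurations\<close>

text \<open>A tableau is represented by the sets \<open>T a\<close> of entries of its columns. Since \<open>c\<^sub>0 = c\<^sub>1\<close> in
  the bounds on the letters, the index \<open>a - 1\<close> is replaced by \<open>max 1 (a - 1)\<close>.\<close>

definition columns :: "nat \<Rightarrow> (nat \<Rightarrow> nat) \<Rightarrow> (nat \<Rightarrow> nat set) \<Rightarrow> bool" where
  "columns n c T \<longleftrightarrow> (\<forall>a\<in>idx n. T a \<subseteq> {1..c (max 1 (a - 1))} \<and> card (T a) = c a)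
     \<and> (\<forall>a. a \<notin> idx n \<longrightarrow> T a = {})"

definition col_bounded :: "nat \<Rightarrow> (nat \<Rightarrow> nat set) \<Rightarrow> rigged \<Rightarrow> bool" where
  "col_bounded n T rc \<longleftrightarrow> (\<forall>a\<in>idx n. \<forall>i x. (i, x) \<in># rc a \<longrightarrow> cnt (T (a + 1)) i - cnt (T a) i \<le> x)"

definition bounded_RC :: "nat \<Rightarrow> (nat \<Rightarrow> nat \<Rightarrow> nat) \<Rightarrow> rigged set" where
  "bounded_RC n L = {rc. partition_seq n (shape rc) \<and> valid n L rc \<and>
     (\<exists>T. columns n (col_size n L (shape rc)) T \<and> col_bounded n T rc)}"

lemma col_boundedD:
  "col_bounded n T rc \<Longrightarrow> a \<in> idx n \<Longrightarrow> (i, x) \<in># rc a \<Longrightarrow> cnt (T (a + 1)) i - cnt (T a) i \<le> x"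
  by (auto simp: col_bounded_def)

lemma columns_finite: "columns n c T \<Longrightarrow> finite (T a)"
  by (cases "a \<in> idx n") (auto simp: columns_def intro: finite_subset)

lemma columnsD:
  assumes "columns n c T" "a \<in> idx n"
  shows "T a \<subseteq> {1..c (max 1 (a - 1))}" "card (T a) = c a"
  using assms unfolding columns_def by blast+

lemma columns_zero: "columns n c T \<Longrightarrow> 0 \<notin> T a"
proof (cases "a \<in> idx n")
  case True
  assume "columns n c T"
  from columnsD(1)[OF this True] show ?thesis by auto
qed (simp add: columns_def)

text \<open>Column \<open>n\<close> counts as a column of length 0, so node \<open>n - 1\<close>
  needs no separate treatment later.\<close>

lemma columns_next:
  assumes "columns n c T" "c n = 0" "a \<in> idx n"
  shows "T (a + 1) \<subseteq> {1..c a}" "card (T (a + 1)) = c (a + 1)"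
proof -
  have "T (a + 1) \<subseteq> {1..c a} \<and> card (T (a + 1)) = c (a + 1)"
  proof (cases "a + 1 \<in> idx n")
    case True
    moreover have "max 1 (a + 1 - 1) = a" using assms(3) by (auto simp: idx_def)
    ultimately show ?thesis using assms(1) unfolding columns_def by (metis (no_types))
  next
    case False
    then have "a + 1 = n" using assms(3) by (auto simp: idx_def)
    then show ?thesis using assms False by (auto simp: columns_def)
  qed
  then show "T (a + 1) \<subseteq> {1..c a}" "card (T (a + 1)) = c (a + 1)" by auto
qed

text \<open>The convention that c_0 equals c_1 leaves column 1 exactly as many letters as it has
  cells.\<close>

lemma columns_first:
  assumes "columns n c T" "1 \<in> idx n"
  shows "T 1 = {1..c 1}"
proof -
  have "T 1 \<subseteq> {1..c 1}" "card (T 1) = card {1..c 1}" using columnsD[OF assms] by simp_all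
  then show ?thesis by (rule card_subset_eq[OF finite_atLeastAtMost])
qed

lemma part_le_sum:
  fixes M :: "nat multiset"
  assumes "i \<in># M"
  shows "i \<le> sum_mset M"
proof -
  obtain R where "M = add_mset i R" using assms by (rule mset_add)
  then show ?thesis by simp
qed

lemma string_le_size: "(i, x) \<in># rc a \<Longrightarrow> i \<le> col_size n L (shape rc) a"
  using in_shape[of i x rc a] part_le_sum col_size_ge by (meson order_trans)

lemma string_vacancy: "valid n L rc \<Longrightarrow> a \<in> idx n \<Longrightarrow> (i, x) \<in># rc a \<Longrightarrow> x \<le> vacancy n L (shape rc) a i"
  by (auto simp: valid_def)

lemma shape_string: "i \<in># shape rc a \<Longrightarrow> \<exists>x. (i, x) \<in># rc a"
  by (auto simp: shape_def)

section \<open>Closure under the operators\<close>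

lemma cartan_simps:
  "cartan a a = 2" "cartan a (a + 1) = -1" "cartan (b + 1) b = -1"
  "\<lbrakk>b \<noteq> a; b \<noteq> a + 1; a \<noteq> b + 1\<rbrakk> \<Longrightarrow> cartan a b = 0"
  by (auto simp: cartan_def)

lemma f_op_closed:
  assumes L: "multiplicity_array n L" and rc: "rc \<in> bounded_RC n L" and a: "a \<in> idx n"
    and f: "f_op n L a rc = Some rc'"
  shows "rc' \<in> bounded_RC n L"
proof -
  define c where "c = col_size n L (shape rc)"
  obtain T where part: "partition_seq n (shape rc)" and val: "valid n L rc"
    and T: "columns n c T" "col_bounded n T rc"
    using rc unfolding bounded_RC_def c_def by blast
  obtain l x where rc'_eq: "rc' = replace_strings n L a (string_if l x) {#(l + 1, x - 1)#} rc"
    and val': "valid n L rc'" and sub: "string_if l x \<subseteq># rc a" and x: "x \<le> 0" "l = 0 \<Longrightarrow> x = 0"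
    and min: "\<And>i y. (i, y) \<in># rc a \<Longrightarrow> x \<le> y \<and> (l < i \<longrightarrow> x < y)"
    by (rule f_op_elim[OF part f]) (rule that)
  have grow: "grow a l (shape rc) (shape rc')"
    unfolding rc'_eq using sub by (rule grow_replace_f)
  have part': "partition_seq n (shape rc')" using grow_partition_seq[OF a grow] part by simp
  have c': "col_size n L (shape rc') b = c b + of_bool (b = a)" for b
    unfolding c_def using grow by (rule grow_col_size)
  have vac: "vacancy n L (shape rc') b i = vacancy n L (shape rc) b i - cartan a b * of_bool (l < i)" for b i
    using grow_vacancy[OF grow a part] .
  have rc': "rc' b = shift (\<lambda>i. - cartan a b * of_bool (l < i)) (if b = a then rc a - string_if l x else rc b)
      + (if b = a then {#(l + 1, x - 1)#} else {#})" for b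
    using replace_strings_eq[of n L a "string_if l x" "{#(l + 1, x - 1)#}" rc b]
    unfolding rc'_eq[symmetric] by (simp add: vac)
  have cn: "c n = 0" unfolding c_def using part by (rule col_size_last)
  have l: "(l, x) \<in># rc a" if "l \<noteq> 0" using sub that by (simp add: string_if_def)
  then have l_le: "l \<le> c a" unfolding c_def using string_le_size[of l x rc a n L] by (cases "l = 0") auto
  have D: "cnt (T (a + 1)) l - cnt (T a) l \<le> x"
  proof (cases "l = 0")
    case True
    then show ?thesis using x columns_zero[OF T(1)] by (simp add: cnt_zero)
  qed (use col_boundedD[OF T(2) a l] in simp)
  note fin = columns_finite[OF T(1), of a]
  note B = columns_next[OF T(1) cn a]
  have A: "T a \<subseteq> {1..c (max 1 (a - 1))}" "card (T a) = c a" using columnsD[OF T(1) a] by auto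
  have "\<exists>s. l < s \<and> s \<notin> T a"
    using fin by (metis finite_nat_set_iff_bounded gt_ex less_trans not_less_iff_gr_or_eq)
  then obtain s where s: "l < s" "s \<notin> T a" and s_least: "\<And>i. l < i \<Longrightarrow> i \<notin> T a \<Longrightarrow> s \<le> i"
    using LeastI_ex[of "\<lambda>s. l < s \<and> s \<notin> T a"] Least_le[of "\<lambda>s. l < s \<and> s \<notin> T a"] by blast
  then have run: "{l<..<s} \<subseteq> T a" by (force simp flip: not_less)
  \<comment> \<open>For \<open>a > 1\<close> the new entry must not exceed \<open>c (a - 1)\<close>: this is where validity of the result is needed.\<close>
  have s_le: "s \<le> c (max 1 (a - 1)) + of_bool (a = 1)"
  proof (cases "a = 1")
    case True
    then have "T a = {1..c 1}" using columns_first T(1) a by simp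
    then show ?thesis using s_least[of "c 1 + 1"] l_le True by simp
  next
    case False
    define c0 where "c0 = c (a - 1)"
    have a2: "max 1 (a - 1) = a - 1" using False a by (auto simp: idx_def)
    show ?thesis
    proof (rule ccontr)
      assume "\<not> ?thesis"
      then have "c0 < s" unfolding a2 c0_def using False by simp
      \<comment> \<open>An overflow means that column \<open>a\<close> is full from
        \<open>l + 1\<close> to \<open>c0\<close>. Counting column \<open>a\<close> up to
        \<open>c0\<close> and column \<open>a + 1\<close> up to \<open>c a\<close> then makes the
        weight coordinate at most the bound at \<open>l\<close>, hence at most
        \<open>x\<close>.\<close>
      then have "{l<..c0} \<subseteq> T a" using run by auto
      have A0: "T a \<subseteq> {1..c0}" using A(1) unfolding a2 c0_def .
      have "c a \<le> c0" using card_mono[OF _ A0] A(2) by simp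
      then have "cnt (T a) c0 = cnt (T a) l + (int c0 - int l)"
        using l_le \<open>{l<..c0} \<subseteq> T a\<close> by (intro cnt_full) auto
      moreover have "cnt (T a) c0 = int (c a)" using cnt_eq_card[OF A0] A(2) by simp
      moreover have "cnt (T (a + 1)) (c a) \<le> cnt (T (a + 1)) l + (int (c a) - int l)"
        using l_le by (rule cnt_lipschitz)
      moreover have "cnt (T (a + 1)) (c a) = int (c (a + 1))" using cnt_eq_card[OF B(1)] B(2) by simp
      moreover have "node_weight L (shape rc) a = int c0 - 2 * int (c a) + int (c (a + 1))"
        using node_weight_eq[OF L a, of "shape rc"] by (simp add: c_def c0_def)
      moreover have "x + 1 \<le> node_weight L (shape rc) a"
      proof -
        \<comment> \<open>At the longest length present the vacancy number is at most the weight
          coordinate, and there it exceeds \<open>x\<close>. For \<open>m = l + 1\<close> the new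
          string is valid after a drop by 2; a longer old string has a label above
          \<open>x\<close>.\<close>
        define m where "m = Max (insert (l + 1) (set_mset (shape rc a)))"
        have m: "m \<in> insert (l + 1) (set_mset (shape rc a))" unfolding m_def by (rule Max_in) auto
        have m_ge: "j \<le> m" if "j \<in> insert (l + 1) (set_mset (shape rc a))" for j
          unfolding m_def using that by (intro Max_ge) auto
        have "x + 1 \<le> vacancy n L (shape rc) a m"
        proof (cases "m = l + 1")
          case True
          have "(l + 1, x - 1) \<in># rc' a" by (simp add: rc')
          then have "x - 1 \<le> vacancy n L (shape rc') a m"
            using string_vacancy[OF val' a] True by simp
          then show ?thesis using True by (simp add: vac cartan_simps)
        next
          case False
          then obtain y where y: "(m, y) \<in># rc a" using m shape_string by blast
          have "l + 1 \<le> m" using m_ge by simp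
          then show ?thesis using min[OF y] string_vacancy[OF val a y] by simp
        qed
        also have "\<dots> \<le> node_weight L (shape rc) a"
          using m_ge by (intro vacancy_le_node_weight part a) simp
        finally show ?thesis .
      qed
      ultimately show False using D by linarith
    qed
  qed
  obtain B' where B': "B' \<subseteq> {1..c a + 1}" "card B' = card (T (a + 1))"
    and B'_ge: "\<And>i. cnt (T (a + 1)) i - of_bool (l < i) \<le> cnt B' i"
    and new: "cnt B' (l + 1) - cnt (insert s (T a)) (l + 1) \<le> x - 1"
    and short: "\<And>i. i \<le> l \<Longrightarrow> cnt B' i - cnt (insert s (T a)) i \<le> cnt (T (a + 1)) i - cnt (T a) i"
    and long: "\<And>i y. \<lbrakk>l < i; i \<le> c a; x + 1 \<le> y; cnt (T (a + 1)) i - cnt (T a) i \<le> y\<rbrakk>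
       \<Longrightarrow> cnt B' i - cnt (insert s (T a)) i \<le> y - 2"
    using raise_columns[OF fin B(1) l_le D s run] by blast
  define T' where "T' = T(a := insert s (T a), a + 1 := B')"
  have T'_simps: "T' a = insert s (T a)" "T' (a + 1) = B'" "\<And>b. b \<noteq> a \<Longrightarrow> b \<noteq> a + 1 \<Longrightarrow> T' b = T b"
    by (auto simp: T'_def)
  have cols: "columns n (col_size n L (shape rc')) T'"
    unfolding columns_def c'
  proof (intro conjI ballI allI impI)
    fix b assume b: "b \<in> idx n"
    have T_b: "T b \<subseteq> {1..c (max 1 (b - 1))}" "card (T b) = c b" using columnsD[OF T(1) b] by auto
    have "T' b \<subseteq> {1..c (max 1 (b - 1)) + of_bool (max 1 (b - 1) = a)} \<and> card (T' b) = c b + of_bool (b = a)"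
    proof -
      consider "b = a" | "b = a + 1" | "b \<noteq> a" "b \<noteq> a + 1" by blast
      then show ?thesis
      proof cases
        case 1
        have "(max 1 (a - 1) = a) = (a = 1)" using a by (auto simp: idx_def max_def)
        moreover have "insert s (T a) \<subseteq> {1..c (max 1 (a - 1)) + of_bool (a = 1)}"
          using A(1) s(1) s_le by force
        moreover have "card (insert s (T a)) = c a + 1" using fin s(2) A(2) by simp
        ultimately show ?thesis unfolding 1 T'_simps by simp
      next
        case 2
        have "max 1 (b - 1) = a" using a 2 by (auto simp: idx_def)
        then show ?thesis unfolding 2 T'_simps using B' B(2) by simp
      next
        case 3
        have "{1..c (max 1 (b - 1))} \<subseteq> {1..c (max 1 (b - 1)) + of_bool (max 1 (b - 1) = a)}" by simp
        with T_b(1) have "T b \<subseteq> {1..c (max 1 (b - 1)) + of_bool (max 1 (b - 1) = a)}" by (rule order_trans)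
        then show ?thesis unfolding T'_simps(3)[OF 3] using 3(1) T_b(2) by simp
      qed
    qed
    then show "T' b \<subseteq> {1..c (max 1 (b - 1)) + of_bool (max 1 (b - 1) = a)}"
      "card (T' b) = c b + of_bool (b = a)" by auto
  next
    fix b assume b: "b \<notin> idx n"
    then have "T b = {}" using T(1) by (auto simp: columns_def)
    \<comment> \<open>For \<open>a = n - 1\<close> the second modified column is column
      \<open>n\<close>, which must stay empty.\<close>
    moreover have "B' = {}" if "T (a + 1) = {}"
      using B' that finite_subset[OF B'(1)] by auto
    ultimately show "T' b = {}" using a b by (cases "b = a + 1") (auto simp: T'_simps T'_def)
  qed
  have "col_bounded n T' rc'"
    unfolding col_bounded_def
  proof (intro ballI allI impI)
    fix b i y assume b: "b \<in> idx n" and y: "(i, y) \<in># rc' b"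
    consider "b = a" | "b = a + 1" | "a = b + 1" | "b \<noteq> a" "b \<noteq> a + 1" "a \<noteq> b + 1" by blast
    then show "cnt (T' (b + 1)) i - cnt (T' b) i \<le> y"
    proof cases
      case 1
      then consider "(i, y) = (l + 1, x - 1)" | "(i, y + 2 * of_bool (l < i)) \<in># rc a"
        using y rc'[of a] by (auto simp: mem_shift cartan_simps dest: in_diffD)
      then show ?thesis
      proof cases
        case 1
        then show ?thesis using new \<open>b = a\<close> T'_simps by simp
      next
        case 2
        note old = col_boundedD[OF T(2) a 2] min[OF 2] string_le_size[of i _ rc a, OF 2, of n L, folded c_def]
        show ?thesis
        proof (cases "l < i")
          case True
          then show ?thesis using long[of i "y + 2"] old \<open>b = a\<close> T'_simps by simp
        next
          case False
          then show ?thesis using short[of i] old \<open>b = a\<close> T'_simps by simp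
        qed
      qed
    next
      case 2
      then have "(i, y - of_bool (l < i)) \<in># rc b"
        using y rc'[of b] cartan_simps(2)[of a] by (auto simp: mem_shift)
      from col_boundedD[OF T(2) b this] show ?thesis
        using B'_ge[of i] 2 T'_simps(2) T'_simps(3)[of "b + 1"] by simp
    next
      case 3
      then have "(i, y - of_bool (l < i)) \<in># rc b"
        using y rc'[of b] cartan_simps(3)[of b] by (auto simp: mem_shift)
      from col_boundedD[OF T(2) b this] show ?thesis
        using cnt_insert[OF s(2), of i] s(1) 3 T'_simps(1) T'_simps(3)[of b]
        by (cases "l < i"; cases "s \<le> i") simp_all
    next
      case 4
      then have "(i, y) \<in># rc b"
        using y rc'[of b] cartan_simps(4)[of b a] by (auto simp: mem_shift)
      from col_boundedD[OF T(2) b this] show ?thesis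
        using 4 T'_simps(3)[of b] T'_simps(3)[of "b + 1"] by auto
    qed
  qed
  then show ?thesis using part' val' cols by (auto simp: bounded_RC_def)
qed


lemma e_op_closed:
  assumes L: "multiplicity_array n L" and rc: "rc \<in> bounded_RC n L" and a: "a \<in> idx n"
    and e: "e_op n L a rc = Some rc'"
  shows "rc' \<in> bounded_RC n L" "f_op n L a rc' = Some rc"
    "\<And>b. sum_mset (shape rc b) = sum_mset (shape rc' b) + of_bool (b = a)"
proof -
  define c where "c = col_size n L (shape rc)"
  obtain T where part: "partition_seq n (shape rc)" and val: "valid n L rc"
    and T: "columns n c T" "col_bounded n T rc"
    using rc unfolding bounded_RC_def c_def by blast
  obtain l x where rc'_eq:
      "rc' = replace_strings n L a {#(l, x)#} (if l = 1 then {#} else {#(l - 1, x + 1)#}) rc"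
    and l: "(l, x) \<in># rc a" and x: "x < 0"
    and min: "\<And>i y. (i, y) \<in># rc a \<Longrightarrow> x \<le> y \<and> (i < l \<longrightarrow> x < y)"
    by (rule e_op_elim[OF e]) (rule that)
  have l1: "1 \<le> l" using partition_seq_pos[OF part l] .
  have grow: "grow a (l - 1) (shape rc') (shape rc)"
    unfolding rc'_eq using l l1 by (rule grow_replace_e)
  show "sum_mset (shape rc b) = sum_mset (shape rc' b) + of_bool (b = a)" for b
    using grow by (rule grow_sum)
  have part': "partition_seq n (shape rc')" using grow_partition_seq[OF a grow] part by simp
  have c': "col_size n L (shape rc') b = c b - of_bool (b = a)" for b
    unfolding c_def using grow_col_size[OF grow, of n L b] by simp
  have "l - 1 < i \<longleftrightarrow> l \<le> i" for i using l1 by auto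
  then have vac: "vacancy n L (shape rc') b i = vacancy n L (shape rc) b i + cartan a b * of_bool (l \<le> i)" for b i
    using grow_vacancy[OF grow a part', of L b i] by simp
  have rc': "rc' b = shift (\<lambda>i. cartan a b * of_bool (l \<le> i)) (if b = a then rc a - {#(l, x)#} else rc b)
      + (if b = a then (if l = 1 then {#} else {#(l - 1, x + 1)#}) else {#})" for b
    using replace_strings_eq[of n L a "{#(l, x)#}" "if l = 1 then {#} else {#(l - 1, x + 1)#}" rc b]
    unfolding rc'_eq[symmetric] vac add_diff_cancel_left' .
  have cn: "c n = 0" unfolding c_def using part by (rule col_size_last)
  have l_le: "l \<le> c a" unfolding c_def using l by (rule string_le_size)
  have D: "cnt (T (a + 1)) l - cnt (T a) l \<le> x" using col_boundedD[OF T(2) a l] .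
  note fin = columns_finite[OF T(1), of a]
  note B = columns_next[OF T(1) cn a]
  have A: "T a \<subseteq> {1..c (max 1 (a - 1))}" "card (T a) = c a" using columnsD[OF T(1) a] by auto
  have x1: "x \<le> -1" using x by simp
  obtain s B' where s: "s \<in> T a" "s \<le> l" and B': "B' \<subseteq> {1..c a - 1}" "card B' = card (T (a + 1))"
    and B'_ge: "\<And>i. i \<le> card (T (a + 1)) \<Longrightarrow> cnt (T (a + 1)) i + of_bool (l \<le> i) \<le> cnt B' i"
    and long: "\<And>i. l \<le> i \<Longrightarrow>
      cnt B' i - (cnt (T a) i - of_bool (s \<le> i)) \<le> cnt (T (a + 1)) i - cnt (T a) i + 2"
    and short: "\<And>i. i < l \<Longrightarrow>
      cnt B' i - (cnt (T a) i - of_bool (s \<le> i)) \<le> max (cnt (T (a + 1)) i - cnt (T a) i) (x + 1)"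
    and new: "cnt B' (l - 1) - (cnt (T a) (l - 1) - of_bool (s \<le> l - 1)) \<le> x + 1"
    by (rule lower_columns[of "T a" "T (a + 1)" l x, unfolded A(2),
          OF fin columns_zero[OF T(1)] B(1) l1 l_le D x1]) (rule that)
  \<comment> \<open>For \<open>a = 1\<close> the letters of column 1 are bounded by its own length,
    which drops by one, so its largest entry goes instead of \<open>s\<close>. This only raises the
    counts of column 1, and there is no node 0 whose bound could suffer.\<close>
  define A' where "A' = (if a = 1 then {1..c a - 1} else T a - {s})"
  have A'_ge: "cnt (T a) i - of_bool (s \<le> i) \<le> cnt A' i" for i
  proof (cases "a = 1")
    case True
    then have T1: "T a = {1..c a}" using columns_first T(1) a by simp
    then have "s \<le> c a" using s(1) by simp
    then show ?thesis unfolding A'_def T1 if_P[OF True] cnt_interval by (cases "s \<le> i") auto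
  qed (simp add: A'_def cnt_remove[OF s(1)])
  have A'_eq: "a \<noteq> 1 \<Longrightarrow> cnt A' i = cnt (T a) i - of_bool (s \<le> i)" for i
    by (simp add: A'_def cnt_remove[OF s(1)])
  define T' where "T' = T(a := A', a + 1 := B')"
  have T'_simps: "T' a = A'" "T' (a + 1) = B'" "\<And>b. b \<noteq> a \<Longrightarrow> b \<noteq> a + 1 \<Longrightarrow> T' b = T b"
    by (auto simp: T'_def)
  have cols: "columns n (col_size n L (shape rc')) T'"
    unfolding columns_def c'
  proof (intro conjI ballI allI impI)
    fix b assume b: "b \<in> idx n"
    have T_b: "T b \<subseteq> {1..c (max 1 (b - 1))}" "card (T b) = c b" using columnsD[OF T(1) b] by auto
    have "T' b \<subseteq> {1..c (max 1 (b - 1)) - of_bool (max 1 (b - 1) = a)} \<and> card (T' b) = c b - of_bool (b = a)"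
    proof -
      consider "b = a" | "b = a + 1" | "b \<noteq> a" "b \<noteq> a + 1" by blast
      then show ?thesis
      proof cases
        case 1
        have "(max 1 (a - 1) = a) = (a = 1)" using a by (auto simp: idx_def max_def)
        moreover have "A' \<subseteq> {1..c (max 1 (a - 1)) - of_bool (a = 1)}"
          using A(1) by (cases "a = 1") (auto simp: A'_def)
        moreover have "card A' = c a - 1" using fin s(1) A(2) by (simp add: A'_def)
        ultimately show ?thesis unfolding 1 T'_simps by simp
      next
        case 2
        have "max 1 (b - 1) = a" using a 2 by (auto simp: idx_def)
        then show ?thesis unfolding 2 T'_simps using B' B(2) by simp
      next
        case 3
        have "max 1 (b - 1) \<noteq> a"
          using 3 b a by (cases "b = 1") (auto simp: idx_def)
        then show ?thesis unfolding T'_simps(3)[OF 3] using 3(1) T_b by simp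
      qed
    qed
    then show "T' b \<subseteq> {1..c (max 1 (b - 1)) - of_bool (max 1 (b - 1) = a)}"
      "card (T' b) = c b - of_bool (b = a)" by auto
  next
    fix b assume b: "b \<notin> idx n"
    then have "T b = {}" using T(1) by (auto simp: columns_def)
    moreover have "B' = {}" if "T (a + 1) = {}"
      using B' that finite_subset[OF B'(1)] by auto
    ultimately show "T' b = {}" using a b by (cases "b = a + 1") (auto simp: T'_simps T'_def)
  qed
  have bounded: "col_bounded n T' rc'"
    unfolding col_bounded_def
  proof (intro ballI allI impI)
    fix b i y assume b: "b \<in> idx n" and y: "(i, y) \<in># rc' b"
    consider "b = a" | "b = a + 1" | "a = b + 1" | "b \<noteq> a" "b \<noteq> a + 1" "a \<noteq> b + 1" by blast
    then show "cnt (T' (b + 1)) i - cnt (T' b) i \<le> y"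
    proof cases
      case 1
      then consider "(i, y) = (l - 1, x + 1)" | "(i, y - 2 * of_bool (l \<le> i)) \<in># rc a"
        using y rc'[of a] by (auto simp: mem_shift cartan_simps dest: in_diffD split: if_splits)
      then show ?thesis
      proof cases
        case 1
        then show ?thesis using new A'_ge[of "l - 1"] \<open>b = a\<close> T'_simps(1,2) by simp
      next
        case 2
        note old = col_boundedD[OF T(2) a 2] min[OF 2]
        show ?thesis
        proof (cases "l \<le> i")
          case True
          then show ?thesis using long[of i] old A'_ge[of i] \<open>b = a\<close> T'_simps(1,2) by simp
        next
          case False
          then have "max (cnt (T (a + 1)) i - cnt (T a) i) (x + 1) \<le> y" using old by simp
          then show ?thesis
            using short[of i] False A'_ge[of i] unfolding \<open>b = a\<close> T'_simps(1,2) by linarith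
        qed
      qed
    next
      case 2
      then have old: "(i, y + of_bool (l \<le> i)) \<in># rc b"
        using y rc'[of b] cartan_simps(2)[of a] by (auto simp: mem_shift)
      \<comment> \<open>Strings at node \<open>a + 1\<close> are no longer than that column, which
        is the range where \<open>B'\<close> is known to gain the unit that the labels lose.\<close>
      have "i \<le> card (T (a + 1))"
        using string_le_size[of i _ rc b, OF old, of n L] 2 B(2) by (simp add: c_def)
      then show ?thesis
        using col_boundedD[OF T(2) b old] B'_ge[of i] 2 T'_simps(2) T'_simps(3)[of "b + 1"] by simp
    next
      case 3
      then have "(i, y + of_bool (l \<le> i)) \<in># rc b"
        using y rc'[of b] cartan_simps(3)[of b] by (auto simp: mem_shift)
      from col_boundedD[OF T(2) b this] show ?thesis
        using A'_eq[of i] s(2) b 3 T'_simps(1) T'_simps(3)[of b]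
        by (cases "l \<le> i"; cases "s \<le> i") (simp_all add: idx_def)
    next
      case 4
      then have "(i, y) \<in># rc b"
        using y rc'[of b] cartan_simps(4)[of b a] by (auto simp: mem_shift)
      from col_boundedD[OF T(2) b this] show ?thesis
        using 4 T'_simps(3)[of b] T'_simps(3)[of "b + 1"] by auto
    qed
  qed
  \<comment> \<open>Concavity of the vacancy numbers between the parts makes the shortened string valid.\<close>
  have room: "x + 1 \<le> vacancy n L (shape rc) a (l - 1)" if l2: "l \<noteq> 1"
  proof (cases "l - 1 \<in># shape rc a")
    case True
    then obtain y where y: "(l - 1, y) \<in># rc a" using shape_string by blast
    then show ?thesis using min[OF y] string_vacancy[OF val a y] l1 by simp
  next
    case False
    define K where "K = insert 0 {j. j \<in># shape rc a \<and> j < l}"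
    define k where "k = Max K"
    have fK: "finite K" "K \<noteq> {}" unfolding K_def by auto
    then have k: "k \<in> K" unfolding k_def by (rule Max_in)
    have k_max: "j \<le> k" if "j \<in> K" for j unfolding k_def using fK(1) that by (rule Max_ge)
    have kl: "k < l - 1"
    proof -
      have "k \<noteq> l - 1" using k False l2 l1 by (auto simp: K_def)
      moreover have "k < l" using k l1 by (auto simp: K_def)
      ultimately show ?thesis by simp
    qed
    \<comment> \<open>Strings shorter than \<open>l\<close> have labels above \<open>x\<close>;
      length 0 acts as a part with vacancy number 0, and \<open>x\<close> is negative.\<close>
    have "x + 1 \<le> vacancy n L (shape rc) a k"
    proof (cases "k = 0")
      case True
      then show ?thesis using x part by (simp add: vacancy_0)
    next
      case False
      then have "k \<in># shape rc a" using k by (simp add: K_def)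
      then obtain y where y: "(k, y) \<in># rc a" using shape_string by blast
      then show ?thesis using min[OF y] string_vacancy[OF val a y] kl by auto
    qed
    moreover have "j \<notin># shape rc a" if "k < j" "j < l" for j
      using k_max[of j] that by (auto simp: K_def)
    ultimately have "x < vacancy n L (shape rc) a (l - 1)"
      using vacancy_ge_between[OF part a kl, of l "x + 1" L x] string_vacancy[OF val a l] l1 by simp
    then show ?thesis by simp
  qed
  have val': "valid n L rc'"
    unfolding rc'_eq
  proof (rule valid_replace[OF val], fold rc'_eq)
    fix i y assume "(i, y) \<in># (if l = 1 then {#} else {#(l - 1, x + 1)#})"
    then show "y \<le> vacancy n L (shape rc') a i"
      using room vac[of a "l - 1"] l1 by (auto split: if_splits)
  qed
  show "rc' \<in> bounded_RC n L" using part' val' cols bounded by (auto simp: bounded_RC_def)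

  \<comment> \<open>A column has at most one entry up to 1, so the bound at length 1 is at least -1.
    Hence a deleted string has label -1, exactly the label that \<open>f_op\<close> gives to the
    string it creates.\<close>
  have l_one: "x = -1" if "l = 1"
  proof -
    have "cnt (T a) 1 \<le> 1"
      using cnt_lipschitz[of 0 1 "T a"] cnt_zero[OF columns_zero[OF T(1)], of a] by simp
    then show ?thesis using D cnt_nonneg[of "T (a + 1)" 1] x that by simp
  qed
  define x' where "x' = (if l = 1 then 0 else x + 1)"
  have x': "x' = x + 1" using l_one by (simp add: x'_def)
  have new': "string_if (l - 1) x' = (if l = 1 then {#} else {#(l - 1, x + 1)#})"
    using l1 by (auto simp: string_if_def x')
  have "l - 1 + 1 = l" "x' - 1 = x" using l1 x' by auto
  then have inv: "replace_strings n L a (string_if (l - 1) x') {#(l - 1 + 1, x' - 1)#} rc' = rc"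
    using l by (simp only: new' rc'_eq) (intro replace_strings_inverse, simp)
  have "f_op n L a rc' = Some (replace_strings n L a (string_if (l - 1) x') {#(l - 1 + 1, x' - 1)#} rc')"
  proof (rule f_op_intro)
    show "string_if (l - 1) x' \<subseteq># rc' a" unfolding rc'[of a] new' by simp
    show "x' \<le> 0" using x by (simp add: x')
    show "x' = 0" if "l - 1 = 0" using that l1 by (simp add: x'_def)
    show "x' \<le> y \<and> (l - 1 < i \<longrightarrow> x' < y)" if y: "(i, y) \<in># rc' a" for i y
    proof -
      consider "(i, y) = (l - 1, x + 1)" | "(i, y - 2 * of_bool (l \<le> i)) \<in># rc a"
        using y rc'[of a] by (auto simp: mem_shift cartan_simps dest: in_diffD split: if_splits)
      then show ?thesis
      proof cases
        case 2
        then show ?thesis using min[OF 2] l1 by (cases "l \<le> i") (auto simp: x')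
      qed (auto simp: x')
    qed
    show "1 \<le> i" if "(i, y) \<in># rc' a" for i y using partition_seq_pos[OF part' that] .
    show "valid n L (replace_strings n L a (string_if (l - 1) x') {#(l - 1 + 1, x' - 1)#} rc')"
      unfolding inv by (rule val)
  qed
  then show "f_op n L a rc' = Some rc" unfolding inv .
qed


text \<open>At part lengths a nonnegative label lies below the vacancy number, and at length 0 that
  number is 0. Concavity fills the gaps between these lengths, and past the last part monotonicity
  takes over.\<close>

lemma vacancy_nonneg:
  assumes part: "partition_seq n (shape rc)" and val: "valid n L rc" and a: "a \<in> idx n"
    and nonneg: "\<And>i x. (i, x) \<in># rc a \<Longrightarrow> 0 \<le> x"
  shows "0 \<le> vacancy n L (shape rc) a i"
proof -
  have parts: "0 \<le> vacancy n L (shape rc) a j" if j: "j = 0 \<or> j \<in># shape rc a" for j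
  proof (cases "j = 0")
    case True
    then show ?thesis using part by (simp add: vacancy_0)
  next
    case False
    then obtain x where x: "(j, x) \<in># rc a" using j shape_string by blast
    then show ?thesis using nonneg[OF x] string_vacancy[OF val a x] by simp
  qed
  define K where "K = insert 0 {j. j \<in># shape rc a \<and> j \<le> i}"
  define k where "k = Max K"
  have fK: "finite K" "K \<noteq> {}" unfolding K_def by auto
  then have k: "k \<in> K" unfolding k_def by (rule Max_in)
  have k_max: "j \<le> k" if "j \<in> K" for j unfolding k_def using fK(1) that by (rule Max_ge)
  have k0: "0 \<le> vacancy n L (shape rc) a k" using k parts by (auto simp: K_def)
  have ki: "k \<le> i" using k by (auto simp: K_def)
  show ?thesis
  proof (cases "\<exists>m. m \<in># shape rc a \<and> i < m")
    case True
    define m where "m = (LEAST m. m \<in># shape rc a \<and> i < m)"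
    have m: "m \<in># shape rc a" "i < m"
      using LeastI_ex[OF True] by (auto simp: m_def)
    have m_min: "m \<le> j" if "j \<in># shape rc a" "i < j" for j
      unfolding m_def by (rule Least_le) (use that in simp)
    show ?thesis
    proof (cases "k = i")
      case False
      have "j \<notin># shape rc a" if "k < j" "j < m" for j
        using k_max[of j] m_min[of j] that by (cases "j \<le> i") (auto simp: K_def)
      then show ?thesis
        using vacancy_ge_between[OF part a, of k i m 0 L 0] k0 parts[of m] m False ki by simp
    qed (use k0 in simp)
  next
    case False
    then have "j \<le> k" if "j \<in># shape rc a" for j
      using k_max[of j] that by (auto simp: K_def not_less)
    then show ?thesis using vacancy_mono_after_parts[OF part a, of k i L] ki k0 by fastforce
  qed
qed

lemma bounded_RC_highest:
  assumes L: "multiplicity_array n L" and rc: "rc \<in> bounded_RC n L"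
    and nonneg: "\<And>a i x. a \<in> idx n \<Longrightarrow> (i, x) \<in># rc a \<Longrightarrow> 0 \<le> x"
  shows "dominant n (wt n L rc)" "rc \<in> RC_bar n L (wt n L rc)"
proof -
  have part: "partition_seq n (shape rc)" and val: "valid n L rc"
    using rc unfolding bounded_RC_def by blast+
  note vac = vacancy_nonneg[OF part val _ nonneg]
  have "0 \<le> node_weight L (shape rc) a" if a: "a \<in> idx n" for a
  proof -
    \<comment> \<open>The size of the partition serves as a length that no part exceeds.\<close>
    have "0 \<le> vacancy n L (shape rc) a (sum_mset (shape rc a))" using a a by (rule vac)
    also have "\<dots> \<le> node_weight L (shape rc) a"
      using part a part_le_sum by (rule vacancy_le_node_weight)
    finally show ?thesis .
  qed
  then show "dominant n (wt n L rc)" by (simp add: dominant_def wt_eq[OF L part])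
  have "shape rc \<in> configs n L (wt n L rc)" using part by (simp add: shape_in_configs_iff)
  moreover have "admissible n L (shape rc)"
    unfolding admissible_def nodes_def by (clarsimp, rule vac)
  moreover have "0 \<le> x \<and> x \<le> vacancy n L (shape rc) a i" if "a \<in> idx n" "(i, x) \<in># rc a" for a i x
    using nonneg[OF that] string_vacancy[OF val that] by simp
  ultimately show "rc \<in> RC_bar n L (wt n L rc)" unfolding RC_bar_def by blast
qed

lemma RC_bar_bounded:
  assumes L: "multiplicity_array n L" and dom: "dominant n \<Lambda>" and rc: "rc \<in> RC_bar n L \<Lambda>"
  shows "rc \<in> bounded_RC n L"
proof -
  define c where "c = col_size n L (shape rc)"
  have part: "partition_seq n (shape rc)" and "wt n L rc = \<Lambda>"
    using rc unfolding RC_bar_def shape_in_configs_iff by blast+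
  then have nw: "0 \<le> node_weight L (shape rc) a" if "a \<in> idx n" for a
    using dom that wt_eq[OF L part, of a] by (auto simp: dominant_def)
  have label: "0 \<le> x \<and> x \<le> vacancy n L (shape rc) a i" if "a \<in> idx n" "(i, x) \<in># rc a" for a i x
    using rc that unfolding RC_bar_def by auto
  have cn: "c n = 0" unfolding c_def using part by (rule col_size_last)
  \<comment> \<open>Dominance makes \<open>c\<close> convex. It starts from \<open>c n = 0\<close>,
    below \<open>c (n - 1)\<close>, so going down from \<open>n\<close> the increments stay
    nonnegative.\<close>
  have dec: "c (n - d) \<le> c (n - Suc d)" if "d < n" for d
    using that
  proof (induction d)
    case (Suc d)
    then have "n - Suc d \<in> idx n" "n - Suc d + 1 = n - d" "n - Suc d - 1 = n - Suc (Suc d)"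
      by (auto simp: idx_def)
    then show ?case
      using nw[of "n - Suc d"] node_weight_eq[OF L, of "n - Suc d" "shape rc"] Suc
      unfolding c_def by simp
  qed (simp add: cn)
  have dec': "c (a + 1) \<le> c a" if "a < n" for a
    using dec[of "n - a - 1"] that by (simp add: Suc_diff_Suc)
  define T where "T a = (if a \<in> idx n then {1..c a} else {})" for a
  have "columns n c T"
    unfolding columns_def
  proof (intro conjI ballI allI impI)
    fix a assume a: "a \<in> idx n"
    have "c a \<le> c (max 1 (a - 1))"
    proof (cases "a = 1")
      case False
      then have "a - 1 + 1 = a" "a - 1 < n" "max 1 (a - 1) = a - 1" using a by (auto simp: idx_def)
      then show ?thesis using dec'[of "a - 1"] by simp
    qed simp
    then show "T a \<subseteq> {1..c (max 1 (a - 1))}" "card (T a) = c a" using a by (simp_all add: T_def)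
  qed (simp add: T_def)
  moreover have "col_bounded n T rc"
    unfolding col_bounded_def
  proof (intro ballI allI impI)
    fix a i x assume a: "a \<in> idx n" and x: "(i, x) \<in># rc a"
    have "cnt (T (a + 1)) i \<le> int (min i (c (a + 1)))" unfolding T_def by (simp only: cnt_interval cnt_empty split: if_split) simp
    also have "\<dots> \<le> int (min i (c a))" using dec'[of a] a by (auto simp: idx_def)
    also have "\<dots> = cnt (T a) i" unfolding T_def if_P[OF a] cnt_interval ..
    finally show "cnt (T (a + 1)) i - cnt (T a) i \<le> x" using label[OF a x] by simp
  qed
  moreover have "valid n L rc" using label by (auto simp: valid_def)
  ultimately show ?thesis using part unfolding bounded_RC_def c_def by blast
qed

theorem RC_eq_bounded_RC:
  assumes L: "multiplicity_array n L"
  shows "RC n L = bounded_RC n L"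
proof (intro equalityI subsetI)
  fix rc assume "rc \<in> RC n L"
  then show "rc \<in> bounded_RC n L"
    by induction (auto intro: RC_bar_bounded[OF L] e_op_closed(1)[OF L] f_op_closed[OF L])
next
  fix rc assume "rc \<in> bounded_RC n L"
  then show "rc \<in> RC n L"
  proof (induction "\<Sum>a\<in>idx n. sum_mset (shape rc a)" arbitrary: rc rule: less_induct)
    case less
    show ?case
    proof (cases "\<exists>a\<in>idx n. e_op n L a rc \<noteq> None")
      case True
      then obtain a rc' where a: "a \<in> idx n" and e: "e_op n L a rc = Some rc'" by blast
      note step = e_op_closed[OF L less.prems a e]
      have "(\<Sum>b\<in>idx n. sum_mset (shape rc' b)) < (\<Sum>b\<in>idx n. sum_mset (shape rc b))"
        by (rule sum_strict_mono_ex1) (use a step(3) in \<open>auto simp: idx_def\<close>)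
      then have "rc' \<in> RC n L" using step(1) by (rule less.hyps)
      then show ?thesis using a step(2) by (rule RC.f_step)
    next
      case False
      then have "0 \<le> x" if "a \<in> idx n" "(i, x) \<in># rc a" for a i x
        using e_op_None[of n L a rc i x] that by blast
      from bounded_RC_highest[OF L less.prems this] show ?thesis by (rule RC.highest)
    qed
  qed
qed


section \<open>Generating functions of riggings\<close>

text \<open>This simplification rule would hide integer powers of \<open>q\<close> from the lemmas on \<open>power_int\<close>.\<close>

declare fls_X_power_int [simp del]

lemma q_poch_nonzero: "q_poch m \<noteq> 0"
proof -
  have "1 - q ^ k \<noteq> 0" if "1 \<le> k" for k
  proof
    assume "1 - q ^ k = 0"
    then have "fls_nth (q ^ k) 0 = fls_nth 1 0" by (metis eq_iff_diff_eq_0)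
    then show False using that by (simp add: fls_X_power_nth split: if_splits)
  qed
  then show ?thesis by (simp add: q_poch_def)
qed

lemma q_poch_Suc: "q_poch (Suc m) = q_poch m * (1 - q ^ Suc m)"
  by (simp add: q_poch_def)

lemma power_int_sum:
  fixes z :: "'a :: field"
  shows "finite A \<Longrightarrow> z \<noteq> 0 \<Longrightarrow> z powi (\<Sum>x\<in>A. h x) = (\<Prod>x\<in>A. z powi h x)"
  by (induction A rule: finite_induct) (simp_all add: power_int_add)

text \<open>The combinatorial form of the q-Pascal rule: split according to whether the largest
  admissible value occurs.\<close>

lemma sum_multisets_Suc:
  fixes lo :: int and z :: "'a :: field"
  assumes "z \<noteq> 0"
  shows "(\<Sum>X\<in>multisets_of_size {lo..lo + int (Suc p)} (Suc m). z powi (\<Sum>\<^sub># X))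
    = (\<Sum>X\<in>multisets_of_size {lo..lo + int p} (Suc m). z powi (\<Sum>\<^sub># X))
      + z powi (lo + int (Suc p)) * (\<Sum>X\<in>multisets_of_size {lo..lo + int (Suc p)} m. z powi (\<Sum>\<^sub># X))"
proof -
  let ?y = "lo + int (Suc p)"
  let ?f = "\<lambda>X. z powi (\<Sum>\<^sub># X)"
  have split: "multisets_of_size {lo..?y} (Suc m)
      = multisets_of_size {lo..lo + int p} (Suc m) \<union> add_mset ?y ` multisets_of_size {lo..?y} m"
  proof (intro equalityI subsetI)
    fix X assume X: "X \<in> multisets_of_size {lo..?y} (Suc m)"
    show "X \<in> multisets_of_size {lo..lo + int p} (Suc m) \<union> add_mset ?y ` multisets_of_size {lo..?y} m"
    proof (cases "?y \<in># X")
      case True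
      then obtain Y where "X = add_mset ?y Y" by (rule mset_add)
      then show ?thesis using X by (auto simp: multisets_of_size_def)
    next
      case False
      have "x \<in> {lo..lo + int p}" if "x \<in># X" for x
      proof -
        have "x \<in> {lo..?y}" "x \<noteq> ?y" using X False that by (auto simp: multisets_of_size_def)
        then show ?thesis by auto
      qed
      then show ?thesis using X by (auto simp: multisets_of_size_def)
    qed
  qed (auto simp: multisets_of_size_def subset_iff)
  have "multisets_of_size {lo..lo + int p} (Suc m) \<inter> add_mset ?y ` multisets_of_size {lo..?y} m = {}"
    by (auto simp: multisets_of_size_def)
  then have "(\<Sum>X\<in>multisets_of_size {lo..?y} (Suc m). ?f X)
      = (\<Sum>X\<in>multisets_of_size {lo..lo + int p} (Suc m). ?f X)
        + (\<Sum>X\<in>add_mset ?y ` multisets_of_size {lo..?y} m. ?f X)"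
    unfolding split by (intro sum.union_disjoint finite_imageI finite_multisets_of_size) auto
  also have "(\<Sum>X\<in>add_mset ?y ` multisets_of_size {lo..?y} m. ?f X)
      = (\<Sum>X\<in>multisets_of_size {lo..?y} m. z powi ?y * ?f X)"
    by (subst sum.reindex) (auto simp: inj_on_def power_int_add assms intro!: sum.cong)
  finally show ?thesis by (simp add: sum_distrib_left)
qed

lemma sum_multisets:
  fixes lo :: int
  shows "(\<Sum>X\<in>multisets_of_size {lo..lo + int p} m. q powi (\<Sum>\<^sub># X))
    = q powi (int m * lo) * (q_poch (m + p) / (q_poch m * q_poch p))"
proof (induction "m + p" arbitrary: m p)
  case 0
  then show ?case by (simp add: q_poch_def)
next
  case (Suc k)
  consider "m = 0" | "p = 0" | m' p' where "m = Suc m'" "p = Suc p'"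
    by (cases m; cases p) auto
  then show ?case
  proof cases
    case 1
    then show ?thesis using q_poch_nonzero by (simp add: q_poch_def)
  next
    case 2
    have "X = replicate_mset m lo" if "X \<in> multisets_of_size {lo} m" for X
      using that set_mset_subset_singletonD[of X lo] by (auto simp: multisets_of_size_def)
    moreover have "replicate_mset m lo \<in> multisets_of_size {lo} m"
      by (simp add: multisets_of_size_def)
    ultimately have "multisets_of_size {lo} m = {replicate_mset m lo}" by blast
    then show ?thesis using 2 q_poch_nonzero[of m] by (simp add: q_poch_def)
  next
    case 3
    define N where "N = q_poch (Suc (m' + p'))"
    \<comment> \<open>All three q-binomials are \<open>P\<close> times a single factor, so the
      recursion reduces to \<open>(1 - q^u) + q^u * (1 - q^v) = 1 - q^(u + v)\<close> with
      \<open>u = Suc p'\<close> and \<open>v = Suc m'\<close>.\<close>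
    define P where "P = N / (q_poch (Suc m') * q_poch (Suc p'))"
    have cancel: "u / v = u / (v * w) * w" if "w \<noteq> 0" for u v w :: "rat fls"
      using that by simp
    have fac: "1 - q ^ Suc j \<noteq> 0" for j
      using q_poch_nonzero[of "Suc j"] by (simp add: q_poch_Suc del: power_Suc)
    have 1: "q_poch (Suc m' + p') / (q_poch (Suc m') * q_poch p') = P * (1 - q ^ Suc p')"
      unfolding P_def q_poch_Suc[of p'] mult.assoc[symmetric]
      by (subst cancel[OF fac[of p']]) (simp add: N_def)
    have 2: "q_poch (m' + Suc p') / (q_poch m' * q_poch (Suc p')) = P * (1 - q ^ Suc m')"
      unfolding P_def q_poch_Suc[of m'] mult.commute[of _ "q_poch (Suc p')"] mult.assoc[symmetric]
      by (subst cancel[OF fac[of m']]) (simp add: N_def)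
    have 3: "q_poch (Suc m' + Suc p') / (q_poch (Suc m') * q_poch (Suc p')) = P * (1 - q ^ (Suc m' + Suc p'))"
      unfolding P_def N_def using q_poch_Suc[of "Suc (m' + p')"] by simp
    have "(\<Sum>X\<in>multisets_of_size {lo..lo + int p} m. q powi (\<Sum>\<^sub># X))
        = q powi (int (Suc m') * lo) * (P * (1 - q ^ Suc p'))
          + q powi (lo + int (Suc p')) * (q powi (int m' * lo) * (P * (1 - q ^ Suc m')))"
      unfolding \<open>m = Suc m'\<close> \<open>p = Suc p'\<close> sum_multisets_Suc[OF fls_X_nonzero]
      using Suc.hyps(1)[of "Suc m'" p'] Suc.hyps(1)[of m' "Suc p'"] Suc.hyps(2) \<open>m = Suc m'\<close> \<open>p = Suc p'\<close>
      unfolding 1 2 by simp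
    also have "q powi (lo + int (Suc p')) * (q powi (int m' * lo) * (P * (1 - q ^ Suc m')))
        = q powi (int (Suc m') * lo) * (P * (q ^ Suc p' * (1 - q ^ Suc m')))"
    proof -
      have "q powi (lo + int (Suc p')) * q powi (int m' * lo) = q powi (int (Suc m') * lo) * q ^ Suc p'"
        by (simp add: power_int_add[symmetric] power_int_of_nat[symmetric] algebra_simps del: power_int_of_nat of_nat_Suc power_Suc)
           (simp add: algebra_simps)
      then show ?thesis by (simp only: mult.assoc[symmetric]) (simp only: mult_ac)
    qed
    also have "q powi (int (Suc m') * lo) * (P * (1 - q ^ Suc p'))
        + q powi (int (Suc m') * lo) * (P * (q ^ Suc p' * (1 - q ^ Suc m')))
        = q powi (int (Suc m') * lo) * (P * (1 - q ^ (Suc m' + Suc p')))"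
      by (simp add: algebra_simps power_add)
    finally show ?thesis unfolding \<open>m = Suc m'\<close> \<open>p = Suc p'\<close> 3 .
  qed
qed

text \<open>For \<open>hi < lo\<close> only the empty multiset exists, which is what the default
  values of \<open>q_binom\<close> record.\<close>

lemma sum_multisets_q_binom:
  fixes lo hi :: int
  shows "(\<Sum>X\<in>multisets_of_size {lo..hi} m. q powi (\<Sum>\<^sub># X)) = q powi (int m * lo) * q_binom m (hi - lo)"
proof (cases "m = 0 \<or> hi < lo")
  case True
  then show ?thesis by (auto simp: q_binom_def)
next
  case False
  then show ?thesis using sum_multisets[of lo "nat (hi - lo)" m] by (simp add: q_binom_def)
qed

section \<open>Riggings of a fixed shape as families of label multisets\<close>

definition labels :: "(nat \<times> int) multiset \<Rightarrow> nat \<Rightarrow> int multiset" where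
  "labels M i = image_mset snd (filter_mset (\<lambda>s. fst s = i) M)"

definition strings :: "nat set \<Rightarrow> (nat \<Rightarrow> int multiset) \<Rightarrow> (nat \<times> int) multiset" where
  "strings A F = (\<Sum>i\<in>A. image_mset (Pair i) (F i))"

lemma count_Pair: "count (image_mset (Pair i) X) s = (if fst s = i then count X (snd s) else 0)"
  by (induction X) (auto simp: prod_eq_iff)

lemma count_labels: "count (labels M i) x = count M (i, x)"
  unfolding labels_def by (induction M) (auto split: if_splits)

lemma count_strings: "finite A \<Longrightarrow> count (strings A F) s = (if fst s \<in> A then count (F (fst s)) (snd s) else 0)"
  by (simp add: strings_def count_sum count_Pair)

lemma size_labels: "size (labels M i) = count (image_mset fst M) i"
  unfolding labels_def by (induction M) auto

lemma mem_labels: "x \<in># labels M i \<longleftrightarrow> (i, x) \<in># M"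
  using count_labels[of M i x] by (metis count_greater_zero_iff)

lemma labels_strings: "finite A \<Longrightarrow> i \<in> A \<Longrightarrow> labels (strings A F) i = F i"
  by (rule multiset_eqI) (simp add: count_labels count_strings)

lemma strings_labels: "finite A \<Longrightarrow> fst ` set_mset M \<subseteq> A \<Longrightarrow> strings A (labels M) = M"
proof (rule multiset_eqI)
  fix s assume A: "finite A" "fst ` set_mset M \<subseteq> A"
  have "count M s = 0" if "fst s \<notin> A" using that A(2) by (metis count_inI image_eqI subsetD)
  then show "count (strings A (labels M)) s = count M s"
    using A(1) by (simp add: count_strings count_labels)
qed

lemma shape_strings: "finite A \<Longrightarrow> image_mset fst (strings A F) = (\<Sum>i\<in>A. replicate_mset (size (F i)) i)"
  unfolding strings_def
  by (induction A rule: finite_induct)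
     (simp_all add: image_mset.compositionality o_def image_mset_const_eq)

lemma sum_labels:
  assumes "finite A" "fst ` set_mset M \<subseteq> A"
  shows "(\<Sum>(i, x)\<in>#M. x) = (\<Sum>i\<in>A. \<Sum>\<^sub># (labels M i))"
  using assms(2)
proof (induction M)
  case (add s M)
  have "(\<Sum>i\<in>A. \<Sum>\<^sub># (labels (add_mset s M) i))
      = (\<Sum>i\<in>A. \<Sum>\<^sub># (labels M i) + (if fst s = i then snd s else 0))"
    by (rule sum.cong) (auto simp: labels_def)
  also have "\<dots> = (\<Sum>(i, x)\<in>#M. x) + snd s"
    using add assms(1) by (simp add: sum.distrib)
  finally show ?case by (simp add: case_prod_unfold)
qed (simp add: labels_def)


definition riggings ::
  "nat \<Rightarrow> (nat \<Rightarrow> nat \<Rightarrow> int) \<Rightarrow> (nat \<Rightarrow> nat \<Rightarrow> int) \<Rightarrow> (nat \<Rightarrow> nat multiset) \<Rightarrow> rigged set" where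
  "riggings n lo hi \<nu> = {rc. shape rc = \<nu> \<and>
     (\<forall>a\<in>idx n. \<forall>i x. (i, x) \<in># rc a \<longrightarrow> lo a i \<le> x \<and> x \<le> hi a i)}"

lemma supp_partition_seq:
  "partition_seq n \<nu> \<Longrightarrow> supp n (num_parts \<nu>) = Sigma (idx n) (\<lambda>a. set_mset (\<nu> a))"
  unfolding supp_num_parts by (intro Sigma_cong refl) (auto simp: partition_seq_def)

text \<open>Labels of equal parts are unordered and the bounds depend only on node and length, so a
  rigging is an independent choice of one multiset for each pair in the support. Restricting to the
  support makes the family extensional.\<close>

lemma bij_riggings:
  assumes part: "partition_seq n \<nu>"
  shows "bij_betw (\<lambda>rc. restrict (\<lambda>(a, i). labels (rc a) i) (supp n (num_parts \<nu>)))
    (riggings n lo hi \<nu>)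
    (PiE (supp n (num_parts \<nu>)) (\<lambda>(a, i). multisets_of_size {lo a i..hi a i} (num_parts \<nu> a i)))"
  (is "bij_betw ?dec ?R ?P")
proof -
  let ?S = "supp n (num_parts \<nu>)"
  define enc :: "(nat \<times> nat \<Rightarrow> int multiset) \<Rightarrow> rigged" where
    "enc F = (\<lambda>a. if a \<in> idx n then strings (set_mset (\<nu> a)) (\<lambda>i. F (a, i)) else {#})" for F
  note S = supp_partition_seq[OF part]
  show ?thesis
  proof (rule bij_betw_byWitness[of _ enc])
    show "\<forall>rc\<in>?R. enc (?dec rc) = rc"
    proof (intro ballI ext)
      fix rc a assume "rc \<in> ?R"
      then have sh: "shape rc = \<nu>" by (simp add: riggings_def)
      show "enc (?dec rc) a = rc a"
      proof (cases "a \<in> idx n")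
        case True
        have "enc (?dec rc) a = strings (set_mset (\<nu> a)) (labels (rc a))"
          using True unfolding enc_def strings_def S by (auto intro!: sum.cong)
        also have "\<dots> = rc a"
          by (rule strings_labels) (auto simp: sh[symmetric] shape_def)
        finally show ?thesis .
      next
        case False
        then have "\<nu> a = {#}" using part by (simp add: partition_seq_def)
        then show ?thesis using False by (simp add: enc_def sh[symmetric] shape_def)
      qed
    qed
    show "\<forall>F\<in>?P. ?dec (enc F) = F"
    proof (intro ballI)
      fix F assume F: "F \<in> ?P"
      have "?dec (enc F) z = F z" for z
        using F by (cases z) (auto simp: S enc_def labels_strings PiE_def extensional_def)
      then show "?dec (enc F) = F" by blast
    qed
    show "?dec ` ?R \<subseteq> ?P"
    proof (intro image_subsetI)
      fix rc assume rc: "rc \<in> ?R"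
      then have sh: "shape rc = \<nu>" by (simp add: riggings_def)
      have "labels (rc a) i \<in> multisets_of_size {lo a i..hi a i} (num_parts \<nu> a i)" if "(a, i) \<in> ?S" for a i
        using rc that unfolding S
        by (auto simp: multisets_of_size_def riggings_def mem_labels size_labels num_parts_def
            shape_def sh[symmetric])
      then show "?dec rc \<in> ?P" by auto
    qed
    show "enc ` ?P \<subseteq> ?R"
    proof (intro image_subsetI)
      fix F assume F: "F \<in> ?P"
      then have FB: "F (a, i) \<in> multisets_of_size {lo a i..hi a i} (count (\<nu> a) i)"
        if "a \<in> idx n" "i \<in># \<nu> a" for a i
        using that PiE_mem[OF F, of "(a, i)"] by (simp add: S num_parts_def)
      have "shape (enc F) a = \<nu> a" for a
      proof (cases "a \<in> idx n")
        case True
        have "shape (enc F) a = (\<Sum>i\<in>set_mset (\<nu> a). replicate_mset (size (F (a, i))) i)"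
          using True by (simp add: shape_def enc_def shape_strings)
        also have "\<dots> = (\<Sum>i\<in>set_mset (\<nu> a). replicate_mset (count (\<nu> a) i) i)"
          using FB[OF True] by (intro sum.cong) (auto simp: multisets_of_size_def)
        also have "\<dots> = \<nu> a"
          by (rule multiset_eqI) (auto simp: count_sum not_in_iff)
        finally show ?thesis .
      next
        case False
        then show ?thesis using part by (simp add: partition_seq_def shape_def enc_def)
      qed
      moreover have "lo a i \<le> x \<and> x \<le> hi a i" if "a \<in> idx n" "(i, x) \<in># enc F a" for a i x
      proof -
        have "0 < count (enc F a) (i, x)" using that(2) by simp
        then have "i \<in># \<nu> a" "x \<in># F (a, i)"
          using that(1) by (auto simp: enc_def count_strings split: if_splits)
        then show ?thesis using FB[OF that(1) \<open>i \<in># \<nu> a\<close>] by (auto simp: multisets_of_size_def)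
      qed
      ultimately show "enc F \<in> ?R" by (auto simp: riggings_def)
    qed
  qed
qed

lemma finite_riggings:
  assumes "partition_seq n \<nu>"
  shows "finite (riggings n lo hi \<nu>)"
proof -
  have "finite (PiE (supp n (num_parts \<nu>)) (\<lambda>(a, i). multisets_of_size {lo a i..hi a i} (num_parts \<nu> a i)))"
    by (intro finite_PiE finite_supp_num_parts) (auto intro: finite_multisets_of_size)
  then show ?thesis using bij_betw_finite[OF bij_riggings[OF assms]] by blast
qed

text \<open>The label sum splits over the pairs (node, length), so the sum over riggings factors
  into one-variable sums. Each lower bound \<open>lo a i\<close> comes out as a power of
  \<open>q\<close>, once for each part.\<close>

lemma sum_riggings:
  assumes part: "partition_seq n \<nu>"
  shows "(\<Sum>rc\<in>riggings n lo hi \<nu>. q powi (cc_rigged n rc)) =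
    q powi (cc_config n \<nu> + (\<Sum>(a, i)\<in>supp n (num_parts \<nu>). int (num_parts \<nu> a i) * lo a i))
    * (\<Prod>(a, i)\<in>supp n (num_parts \<nu>). q_binom (num_parts \<nu> a i) (hi a i - lo a i))"
proof -
  let ?S = "supp n (num_parts \<nu>)"
  let ?dec = "\<lambda>rc. restrict (\<lambda>(a, i). labels (rc a) i) ?S"
  let ?B = "\<lambda>z. multisets_of_size {lo (fst z) (snd z)..hi (fst z) (snd z)} (num_parts \<nu> (fst z) (snd z))"
  note fin = finite_supp_num_parts[of n \<nu>]
  have B: "(\<lambda>(a, i). multisets_of_size {lo a i..hi a i} (num_parts \<nu> a i)) = ?B"
    by (simp add: case_prod_unfold)
  have cc: "cc_rigged n rc = cc_config n \<nu> + (\<Sum>z\<in>?S. \<Sum>\<^sub># (?dec rc z))" if "rc \<in> riggings n lo hi \<nu>" for rc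
  proof -
    have sh: "shape rc = \<nu>" using that by (simp add: riggings_def)
    have "(\<Sum>a\<in>idx n. \<Sum>(i, x)\<in>#rc a. x) = (\<Sum>a\<in>idx n. \<Sum>i\<in>set_mset (\<nu> a). \<Sum>\<^sub># (labels (rc a) i))"
      by (intro sum.cong refl sum_labels) (auto simp: sh[symmetric] shape_def)
    also have "\<dots> = (\<Sum>z\<in>?S. \<Sum>\<^sub># (labels (rc (fst z)) (snd z)))"
      unfolding supp_partition_seq[OF part]
      by (subst sum.Sigma) (auto simp: idx_def case_prod_unfold)
    also have "\<dots> = (\<Sum>z\<in>?S. \<Sum>\<^sub># (?dec rc z))"
      by (intro sum.cong refl) (simp add: case_prod_unfold)
    finally show ?thesis by (simp add: cc_rigged_def sh)
  qed
  have "(\<Sum>rc\<in>riggings n lo hi \<nu>. q powi (cc_rigged n rc))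
      = (\<Sum>rc\<in>riggings n lo hi \<nu>. q powi (cc_config n \<nu> + (\<Sum>z\<in>?S. \<Sum>\<^sub># (?dec rc z))))"
    by (intro sum.cong refl) (simp only: cc)
  also have "\<dots> = (\<Sum>F\<in>PiE ?S ?B. q powi (cc_config n \<nu> + (\<Sum>z\<in>?S. \<Sum>\<^sub># (F z))))"
    by (rule sum.reindex_bij_betw[OF bij_riggings[OF part, of lo hi, unfolded B]])
  also have "\<dots> = q powi cc_config n \<nu> * (\<Sum>F\<in>PiE ?S ?B. \<Prod>z\<in>?S. q powi (\<Sum>\<^sub># (F z)))"
    by (simp add: power_int_add power_int_sum[OF fin] sum_distrib_left)
  also have "(\<Sum>F\<in>PiE ?S ?B. \<Prod>z\<in>?S. q powi (\<Sum>\<^sub># (F z))) = (\<Prod>z\<in>?S. \<Sum>X\<in>?B z. q powi (\<Sum>\<^sub># X))"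
    by (rule prod_sum_PiE[symmetric, OF fin]) (auto intro: finite_multisets_of_size)
  also have "\<dots> = (\<Prod>z\<in>?S. q powi (int (num_parts \<nu> (fst z) (snd z)) * lo (fst z) (snd z))
      * q_binom (num_parts \<nu> (fst z) (snd z)) (hi (fst z) (snd z) - lo (fst z) (snd z)))"
    by (simp only: sum_multisets_q_binom)
  finally show ?thesis
    by (simp add: prod.distrib power_int_add power_int_sum[OF fin] case_prod_unfold mult.assoc)
qed

section \<open>Tableaux\<close>

definition tableau_columns :: "nat \<Rightarrow> (nat \<Rightarrow> nat) \<Rightarrow> (nat \<times> nat \<Rightarrow> nat) \<Rightarrow> nat \<Rightarrow> nat set" where
  "tableau_columns n lam t a = (if a \<in> idx n then (\<lambda>j. t (j, a)) ` {1..col_len n lam a} else {})"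

lemma col_len_pred: "a \<in> idx n \<Longrightarrow> col_len n lam (a - 1) = col_len n lam (max 1 (a - 1))"
  by (auto simp: col_len_def idx_def max_def numeral_2_eq_2)

lemma tableau_inj:
  assumes "t \<in> tableaux n lam" "a \<in> idx n"
  shows "inj_on (\<lambda>j. t (j, a)) {1..col_len n lam a}"
proof (rule linorder_inj_onI')
  fix i j assume "i \<in> {1..col_len n lam a}" "j \<in> {1..col_len n lam a}" "i < j"
  then have "(i, a) \<in> cells n lam" "(j, a) \<in> cells n lam" using assms(2) by (auto simp: cells_def)
  then have "t (j, a) < t (i, a)" using assms(1) \<open>i < j\<close> unfolding tableaux_def by blast
  then show "t (i, a) \<noteq> t (j, a)" by simp
qed

lemma columns_tableau_columns:
  assumes "t \<in> tableaux n lam"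
  shows "columns n (col_len n lam) (tableau_columns n lam t)"
  unfolding columns_def
proof (intro conjI ballI allI impI)
  fix a assume a: "a \<in> idx n"
  have "t (j, a) \<in> {1..col_len n lam (a - 1)}" if "j \<in> {1..col_len n lam a}" for j
  proof -
    have "(j, a) \<in> cells n lam" using that a by (auto simp: cells_def)
    moreover have "t \<in> PiE (cells n lam) (\<lambda>(j, k). {1..col_len n lam (k - 1)})"
      using assms unfolding tableaux_def by blast
    ultimately show ?thesis using PiE_mem by fastforce
  qed
  then show "tableau_columns n lam t a \<subseteq> {1..col_len n lam (max 1 (a - 1))}"
    unfolding tableau_columns_def if_P[OF a] col_len_pred[OF a, symmetric] by blast
  show "card (tableau_columns n lam t a) = col_len n lam a"
    using card_image[OF tableau_inj[OF assms a]] a by (simp add: tableau_columns_def)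
qed (simp add: tableau_columns_def)

lemma cnt_tableau_columns:
  assumes "t \<in> tableaux n lam" "1 \<le> a" "a \<le> n"
  shows "(\<Sum>j=1..col_len n lam a. of_bool (i \<ge> t (j, a))) = cnt (tableau_columns n lam t a) i"
proof (cases "a \<in> idx n")
  case True
  let ?J = "{j \<in> {1..col_len n lam a}. t (j, a) \<le> i}"
  have "tableau_columns n lam t a \<inter> {..i} = (\<lambda>j. t (j, a)) ` ?J"
    using True by (auto simp: tableau_columns_def)
  moreover have "inj_on (\<lambda>j. t (j, a)) ?J"
    using tableau_inj[OF assms(1) True] by (rule inj_on_subset) auto
  ultimately have "cnt (tableau_columns n lam t a) i = int (card ?J)"
    unfolding cnt_def by (simp only: card_image)
  then show ?thesis by (simp add: sum_of_bool_eq Int_def)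
next
  case False
  \<comment> \<open>Column \<open>n\<close> enters through \<open>low\<close> at node
    \<open>n - 1\<close>; its length is an empty sum.\<close>
  then have "a = n" using assms by (auto simp: idx_def)
  then show ?thesis using False by (simp add: tableau_columns_def col_len_def)
qed

lemma low_eq_cnt:
  assumes "t \<in> tableaux n lam" "a \<in> idx n"
  shows "low n lam t a i = cnt (tableau_columns n lam t (a + 1)) i - cnt (tableau_columns n lam t a) i"
  using cnt_tableau_columns[OF assms(1), of a i] cnt_tableau_columns[OF assms(1), of "a + 1" i] assms(2)
  by (simp add: low_def idx_def)

text \<open>A strictly decreasing column is its set of entries listed downwards, hence the reversed
  sorted list.\<close>

lemma columns_imp_tableau:
  assumes T: "columns n (col_len n lam) T"
  shows "\<exists>t\<in>tableaux n lam. tableau_columns n lam t = T"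
proof -
  define xs where "xs k = rev (sorted_list_of_set (T k))" for k
  define t where "t = restrict (\<lambda>(j, k). xs k ! (j - 1)) (cells n lam)"
  note fin = columns_finite[OF T]
  have len: "length (xs k) = col_len n lam k" if "k \<in> idx n" for k
    using columnsD(2)[OF T that] by (simp add: xs_def)
  have set: "set (xs k) = T k" for k using fin by (simp add: xs_def)
  have "sorted_wrt (<) (sorted_list_of_set (T k))" for k by simp
  then have dec: "sorted_wrt (>) (xs k)" for k by (simp add: xs_def sorted_wrt_rev)
  have t: "t (j, k) = xs k ! (j - 1)" "j - 1 < length (xs k)" "k \<in> idx n" "1 \<le> j" if "(j, k) \<in> cells n lam" for j k
    using that len[of k] by (auto simp: t_def cells_def)
  have "t \<in> tableaux n lam"
    unfolding tableaux_def
  proof (intro CollectI conjI allI impI)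
    show "t \<in> PiE (cells n lam) (\<lambda>(j, k). {1..col_len n lam (k - 1)})"
    proof (intro PiE_I)
      fix z assume z: "z \<in> cells n lam"
      obtain j k where jk: "z = (j, k)" by (cases z)
      note t' = t[OF z[unfolded jk]]
      have "t z \<in> T k" unfolding jk t'(1) set[symmetric] using t'(2) by (rule nth_mem)
      also have "\<dots> \<subseteq> {1..col_len n lam (k - 1)}"
        using columnsD(1)[OF T t'(3)] unfolding col_len_pred[OF t'(3)] .
      finally show "t z \<in> (case z of (j, k) \<Rightarrow> {1..col_len n lam (k - 1)})" by (simp add: jk)
    qed (simp add: t_def)
    fix j j' k assume *: "(j, k) \<in> cells n lam \<and> (j', k) \<in> cells n lam \<and> j < j'"
    have "1 \<le> j" using * t(4)[of j k] by blast
    then have "j - 1 < j' - 1" using * by (simp add: diff_less_mono)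
    then show "t (j', k) < t (j, k)"
      using * t[of j k] t[of j' k] sorted_wrt_nth_less[OF dec, of "j - 1" "j' - 1" k] by simp
  qed
  moreover have "tableau_columns n lam t a = T a" for a
  proof (cases "a \<in> idx n")
    case True
    have "(\<lambda>j. t (j, a)) ` {1..col_len n lam a} = (\<lambda>j. xs a ! (j - 1)) ` {1..col_len n lam a}"
      using True by (intro image_cong) (auto simp: t_def cells_def)
    also have "\<dots> = (\<lambda>j. xs a ! j) ` {0..<col_len n lam a}"
    proof (rule set_eqI)
      fix y
      have "y \<in> (\<lambda>j. xs a ! (j - 1)) ` {1..col_len n lam a} \<longleftrightarrow> (\<exists>j\<in>{1..col_len n lam a}. y = xs a ! (j - 1))"
        by blast
      also have "\<dots> \<longleftrightarrow> (\<exists>j\<in>{0..<col_len n lam a}. y = xs a ! j)"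
      proof
        assume "\<exists>j\<in>{1..col_len n lam a}. y = xs a ! (j - 1)"
        then obtain j where "1 \<le> j" "j \<le> col_len n lam a" "y = xs a ! (j - 1)" by auto
        then show "\<exists>j\<in>{0..<col_len n lam a}. y = xs a ! j" by (intro bexI[of _ "j - 1"]) auto
      next
        assume "\<exists>j\<in>{0..<col_len n lam a}. y = xs a ! j"
        then obtain j where "j < col_len n lam a" "y = xs a ! j" by auto
        then show "\<exists>j\<in>{1..col_len n lam a}. y = xs a ! (j - 1)" by (intro bexI[of _ "Suc j"]) auto
      qed
      finally show "y \<in> (\<lambda>j. xs a ! (j - 1)) ` {1..col_len n lam a} \<longleftrightarrow> y \<in> (\<lambda>j. xs a ! j) ` {0..<col_len n lam a}"
        by blast
    qed
    also have "\<dots> = T a" unfolding set[symmetric] set_conv_nth len[OF True] by auto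
    finally show ?thesis using True by (simp add: tableau_columns_def)
  next
    case False
    then show ?thesis using T by (simp add: tableau_columns_def columns_def)
  qed
  ultimately show ?thesis by blast
qed


section \<open>Fixing the weight, and inclusion-exclusion\<close>

lemma weight_of_tuple_apply:
  "weight_of_tuple n lam b = (if b \<in> idx n then int (lam b) - int (lam (b + 1)) else 0)"
proof -
  have "weight_of_tuple n lam b = (\<Sum>a\<in>idx n. if b = a then int (lam a) - int (lam (a + 1)) else 0)"
    unfolding weight_of_tuple_def fund_weight_def by (intro sum.cong) auto
  then show ?thesis by (simp add: idx_def)
qed

text \<open>Both sequences have the coordinates of the weight as second differences and vanish at
  \<open>n\<close>; the hypothesis \<open>total\<close> makes them agree at the other end, and
  \<open>cartan_inj\<close> gives uniqueness.\<close>

lemma col_size_eq_col_len: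
  assumes n: "2 \<le> n" and L: "multiplicity_array n L"
    and total: "(\<Sum>i=1..n. lam i) = (\<Sum>(a, i)\<in>supp n L. a * i * L a i)"
    and part: "partition_seq n (shape rc)" and wt: "wt n L rc = weight_of_tuple n lam"
    and k: "1 \<le> k" "k \<le> n"
  shows "col_size n L (shape rc) k = col_len n lam k"
proof -
  \<comment> \<open>Unlike \<open>col_len\<close>, whose value at 0 repeats that at 1,
    \<open>e 0\<close> is the full sum of the tuple, as the boundary value at 0 requires.\<close>
  define e where "e k = (\<Sum>i=k+1..n. lam i)" for k
  define z where "z k = int (col_size n L (shape rc) k) - int (e k)" for k
  have e_step: "e b = lam (b + 1) + e (b + 1)" if "b < n" for b
    unfolding e_def using that by (simp add: sum.atLeast_Suc_atMost)
  have "shape rc 0 = {#}" using part by (simp add: partition_seq_def idx_def)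
  then have "col_size n L (shape rc) 0 = e 0"
    unfolding col_size_def e_def using total
    by (simp add: case_prod_unfold mult_ac)
  then have z0: "z 0 = 0" by (simp add: z_def)
  have zn: "z n = 0" using col_size_last[OF part, of L] by (simp add: z_def e_def)
  have "2 * z b = z (b - 1) + z (b + 1)" if b: "b \<in> idx n" for b
  proof -
    obtain b0 where b0: "b = Suc b0" using b by (cases b) (auto simp: idx_def)
    have b': "b0 < n" "b < n" using b b0 by (auto simp: idx_def)
    have "node_weight L (shape rc) b = int (lam b) - int (lam (b + 1))"
      using wt_eq[OF L part, of b] b by (simp add: wt weight_of_tuple_apply)
    then show ?thesis
      using node_weight_eq[OF L b, of "shape rc"] e_step[OF b'(1)] e_step[OF b'(2)]
      unfolding z_def b0 by simp
  qed
  then have "z k = 0" using cartan_inj[of z n k] z0 zn k(2) by blast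
  moreover have "e k = col_len n lam k" using k(1) by (simp add: e_def col_len_def)
  ultimately show ?thesis by (simp add: z_def)
qed

lemma columns_cong: "(\<And>a. 1 \<le> a \<Longrightarrow> a \<le> n \<Longrightarrow> c a = c' a) \<Longrightarrow> columns n c T \<longleftrightarrow> columns n c' T"
proof -
  assume eq: "\<And>a. 1 \<le> a \<Longrightarrow> a \<le> n \<Longrightarrow> c a = c' a"
  have "c a = c' a \<and> c (max 1 (a - 1)) = c' (max 1 (a - 1))" if "a \<in> idx n" for a
    using that by (auto simp: idx_def intro!: eq)
  then show ?thesis unfolding columns_def by simp
qed

lemma RC_wt_eq:
  assumes n: "2 \<le> n" and L: "multiplicity_array n L"
    and total: "(\<Sum>i=1..n. lam i) = (\<Sum>(a, i)\<in>supp n L. a * i * L a i)"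
  shows "RC_wt n L (weight_of_tuple n lam) = (\<Union>t\<in>tableaux n lam.
    \<Union>\<nu>\<in>configs n L (weight_of_tuple n lam). riggings n (low n lam t) (vacancy n L \<nu>) \<nu>)"
    (is "_ = ?U")
proof (rule set_eqI)
  fix rc
  let ?\<Lambda> = "weight_of_tuple n lam"
  have "rc \<in> RC_wt n L ?\<Lambda> \<longleftrightarrow> shape rc \<in> configs n L ?\<Lambda> \<and> valid n L rc \<and>
      (\<exists>T. columns n (col_size n L (shape rc)) T \<and> col_bounded n T rc)"
    unfolding RC_wt_def RC_eq_bounded_RC[OF L] bounded_RC_def shape_in_configs_iff by blast
  also have "\<dots> \<longleftrightarrow> shape rc \<in> configs n L ?\<Lambda> \<and> valid n L rc \<and>
      (\<exists>T. columns n (col_len n lam) T \<and> col_bounded n T rc)"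
    using columns_cong[of n "col_size n L (shape rc)" "col_len n lam"] col_size_eq_col_len[OF n L total]
    unfolding shape_in_configs_iff by blast
  also have "\<dots> \<longleftrightarrow> shape rc \<in> configs n L ?\<Lambda> \<and> valid n L rc \<and>
      (\<exists>t\<in>tableaux n lam. col_bounded n (tableau_columns n lam t) rc)"
    using columns_imp_tableau columns_tableau_columns by metis
  also have "\<dots> \<longleftrightarrow> shape rc \<in> configs n L ?\<Lambda> \<and>
      (\<exists>t\<in>tableaux n lam. rc \<in> riggings n (low n lam t) (vacancy n L (shape rc)) (shape rc))"
  proof -
    have "valid n L rc \<and> col_bounded n (tableau_columns n lam t) rc \<longleftrightarrow>
        rc \<in> riggings n (low n lam t) (vacancy n L (shape rc)) (shape rc)" if "t \<in> tableaux n lam" for t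
      using low_eq_cnt[OF that] by (force simp: valid_def col_bounded_def riggings_def)
    then show ?thesis by blast
  qed
  also have "\<dots> \<longleftrightarrow> rc \<in> ?U" by (auto simp: riggings_def)
  finally show "rc \<in> RC_wt n L ?\<Lambda> \<longleftrightarrow> rc \<in> ?U" .
qed

lemma configs_partition_seq: "\<nu> \<in> configs n L \<Lambda> \<Longrightarrow> partition_seq n \<nu>"
  by (simp add: configs_def)

text \<open>A rigged configuration determines its shape, so the same \<open>\<nu>\<close> serves all
  \<open>t\<close> and the intersection passes inside the union. Satisfying all lower bounds then
  means satisfying their maximum.\<close>

lemma Inter_riggings:
  assumes "S \<in> tableau_sets n lam"
  shows "(\<Inter>t\<in>S. \<Union>\<nu>\<in>C. riggings n (low n lam t) (hi \<nu>) \<nu>) = (\<Union>\<nu>\<in>C. riggings n (low_set n lam S) (hi \<nu>) \<nu>)"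
proof -
  have S: "finite S" "S \<noteq> {}"
    using assms finite_subset[OF _ finite_tableaux] by (auto simp: tableau_sets_def)
  then have "low_set n lam S a i \<le> x \<longleftrightarrow> (\<forall>t\<in>S. low n lam t a i \<le> x)" for a i x
    by (simp add: low_set_def)
  then show ?thesis using S(2) by (auto simp: riggings_def)
qed

theorem mainTheorem5:
  fixes n :: nat and L :: "nat \<Rightarrow> nat \<Rightarrow> nat" and lam :: "nat \<Rightarrow> nat"
  assumes "n \<ge> 2"
    and "multiplicity_array n L"
    and "(\<Sum>i=1..n. lam i) = (\<Sum>(a, i)\<in>supp n L. a * i * L a i)"
  shows "finite (RC_wt n L (weight_of_tuple n lam)) \<and>
    M_gf n L lam =
      (\<Sum>S\<in>tableau_sets n lam. (-1) ^ (card S + 1) *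
        (\<Sum>\<nu>\<in>configs n L (weight_of_tuple n lam).
          q powi (cc_config n \<nu>
            + (\<Sum>(a, i)\<in>supp n (num_parts \<nu>). int (num_parts \<nu> a i) * low_set n lam S a i)) *
          (\<Prod>(a, i)\<in>supp n (num_parts \<nu>).
            q_binom (num_parts \<nu> a i) (vacancy n L \<nu> a i - low_set n lam S a i))))"
proof -
  let ?C = "configs n L (weight_of_tuple n lam)"
  let ?R = "\<lambda>t. \<Union>\<nu>\<in>?C. riggings n (low n lam t) (vacancy n L \<nu>) \<nu>"
  let ?f = "\<lambda>X. \<Sum>rc\<in>X. q powi (cc_rigged n rc)"
  have finR: "finite (?R t)" for t
    by (intro finite_UN_I finite_configs finite_riggings configs_partition_seq)
  note RC = RC_wt_eq[OF assms]
  have "finite (RC_wt n L (weight_of_tuple n lam))"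
    unfolding RC by (intro finite_UN_I finite_tableaux finR)
  moreover have "M_gf n L lam = ?f (\<Union>(?R ` tableaux n lam))"
    by (simp only: M_gf_def RC)
  moreover have "\<dots> = (\<Sum>S | S \<subseteq> tableaux n lam \<and> S \<noteq> {}. (-1) ^ (card S + 1) * ?f (\<Inter>(?R ` S)))"
  proof -
    interpret Incl_Excl finite ?f
      by unfold_locales (auto simp: sum.union_disjoint disjnt_def)
    show ?thesis using finite_tableaux finR by (rule restricted_indexed)
  qed
  moreover have "?f (\<Inter>(?R ` S)) = (\<Sum>\<nu>\<in>?C.
        q powi (cc_config n \<nu>
          + (\<Sum>(a, i)\<in>supp n (num_parts \<nu>). int (num_parts \<nu> a i) * low_set n lam S a i)) *
        (\<Prod>(a, i)\<in>supp n (num_parts \<nu>).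
          q_binom (num_parts \<nu> a i) (vacancy n L \<nu> a i - low_set n lam S a i)))"
    if "S \<in> tableau_sets n lam" for S
  proof -
    \<comment> \<open>The union over \<open>\<nu>\<close> is disjoint, again because the shape is
      determined.\<close>
    have "?f (\<Inter>(?R ` S)) = (\<Sum>\<nu>\<in>?C. ?f (riggings n (low_set n lam S) (vacancy n L \<nu>) \<nu>))"
      unfolding Inter_riggings[OF that]
    proof (rule sum.UNION_disjoint[OF finite_configs])
      show "\<forall>\<nu>\<in>?C. finite (riggings n (low_set n lam S) (vacancy n L \<nu>) \<nu>)"
        by (intro ballI finite_riggings configs_partition_seq)
    qed (auto simp: riggings_def)
    also have "\<dots> = (\<Sum>\<nu>\<in>?C.
        q powi (cc_config n \<nu>
          + (\<Sum>(a, i)\<in>supp n (num_parts \<nu>). int (num_parts \<nu> a i) * low_set n lam S a i)) *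
        (\<Prod>(a, i)\<in>supp n (num_parts \<nu>).
          q_binom (num_parts \<nu> a i) (vacancy n L \<nu> a i - low_set n lam S a i)))"
      by (intro sum.cong refl sum_riggings configs_partition_seq)
    finally show ?thesis .
  qed
  ultimately show ?thesis by (simp add: tableau_sets_def)
qed

end
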